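(* There is a Friedberg numbering of the family of all Martin-Löf random left-c.e. reals.
   Context: $\mathbb{Q}_2=\{a/2^b\le 1 : a,b\in\omega\}$ is the set of dyadic rationals. For $q\in\mathbb{Q}_2$ and a real $x\in 2^\omega$, $q<x$ means that $q$ is less than the real number $\sum_{i\in\omega}x(i)2^{-(i+1)}$. A real $x\in 2^\omega$ is left-c.e. if $\{q\in\mathbb{Q}_2: q<x\}$ is computably enumerable. An effective numbering of a family $\mathcal{R}$ of left-c.e. reals is a map $r:\omega\to\mathcal{R}$ that is onto $\mathcal{R}$ and such that $\{(q,e)\in\mathbb{Q}_2\times\omega : q<r(e)\}$ is computably enumerable. If $r$ is also injective, it is called a Friedberg numbering of $\mathcal{R}$. $K$ denotes prefix-free Kolmogorov complexity (with respect to a fixed universal prefix-free machine); by Schnorr's Theorem, $x\in 2^\omega$ is Martin-Löf random if and only if there is a constant $c$ such that $K(x\upharpoonright n)\ge n-c$ for all $n$. *)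

theory Defs
  imports
    Complex_Main
    "HOL-Library.Nat_Bijection"
    "HOL-Library.Sublist"
    "HOL-Library.Extended_Nat"
begin

(* Partial recursive functions of one argument, with several arguments passed through
   the Cantor pairing prod_encode.  The pairing and its projections are primitive recursive,
   so this is the unary part of Kleene's class of partial recursive functions. *)

definition is_first_zero :: "(nat \<rightharpoonup> nat) \<Rightarrow> nat \<Rightarrow> nat \<Rightarrow> bool" where
  "is_first_zero f a n \<longleftrightarrow>
     f (prod_encode (a, n)) = Some 0 \<and> (\<forall>m<n. \<exists>y. f (prod_encode (a, m)) = Some (Suc y))"

inductive partial_recursive :: "(nat \<rightharpoonup> nat) \<Rightarrow> bool" where
  zero: "partial_recursive (\<lambda>_. Some 0)"
| succ: "partial_recursive (\<lambda>n. Some (Suc n))"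
| left: "partial_recursive (\<lambda>n. Some (fst (prod_decode n)))"
| right: "partial_recursive (\<lambda>n. Some (snd (prod_decode n)))"
| pair: "partial_recursive f \<Longrightarrow> partial_recursive g \<Longrightarrow>
    partial_recursive
      (\<lambda>n. Option.bind (f n) (\<lambda>a. Option.bind (g n) (\<lambda>b. Some (prod_encode (a, b)))))"
| comp: "partial_recursive f \<Longrightarrow> partial_recursive g \<Longrightarrow>
    partial_recursive (\<lambda>n. Option.bind (g n) f)"
| prec: "partial_recursive f \<Longrightarrow> partial_recursive g \<Longrightarrow>
    partial_recursive
      (\<lambda>n. case prod_decode n of (a, k) \<Rightarrow>
         rec_nat (f a)
           (\<lambda>m v. Option.bind v (\<lambda>y. g (prod_encode (a, prod_encode (m, y))))) k)"
| minim: "partial_recursive f \<Longrightarrow>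
    partial_recursive
      (\<lambda>a. if \<exists>n. is_first_zero f a n then Some (THE n. is_first_zero f a n) else None)"

definition ce_set :: "nat set \<Rightarrow> bool" where
  "ce_set A \<longleftrightarrow> (\<exists>f. partial_recursive f \<and> dom f = A)"


type_synonym bitseq = "nat \<Rightarrow> bool"

definition real_of_bitseq :: "bitseq \<Rightarrow> real" where
  "real_of_bitseq x = (\<Sum>i. of_bool (x i) / 2 ^ (i + 1))"

definition dyadics :: "real set" where
  "dyadics = {q. (\<exists>a b :: nat. q = real a / 2 ^ b) \<and> q \<le> 1}"

(* Computable enumerability of sets of dyadic rationals is understood through this coding of
   fractions.  A dyadic has many codes, and codes of numbers above 1 are simply unused. *)
definition dyadic_of_code :: "nat \<Rightarrow> real" where
  "dyadic_of_code n = (case prod_decode n of (a, b) \<Rightarrow> real a / 2 ^ b)"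

definition ce_dyadic_set :: "real set \<Rightarrow> bool" where
  "ce_dyadic_set S \<longleftrightarrow> ce_set {n. dyadic_of_code n \<in> S}"

definition ce_dyadic_nat_set :: "(real \<times> nat) set \<Rightarrow> bool" where
  "ce_dyadic_nat_set S \<longleftrightarrow> ce_set {prod_encode (n, e) | n e. (dyadic_of_code n, e) \<in> S}"

definition left_ce :: "bitseq \<Rightarrow> bool" where
  "left_ce x \<longleftrightarrow> ce_dyadic_set {q \<in> dyadics. q < real_of_bitseq x}"

definition effective_numbering :: "(nat \<Rightarrow> bitseq) \<Rightarrow> bitseq set \<Rightarrow> bool" where
  "effective_numbering r R \<longleftrightarrow>
     range r = R \<and>
     ce_dyadic_nat_set {(q, e). q \<in> dyadics \<and> q < real_of_bitseq (r e)}"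

definition friedberg_numbering :: "(nat \<Rightarrow> bitseq) \<Rightarrow> bitseq set \<Rightarrow> bool" where
  "friedberg_numbering r R \<longleftrightarrow> effective_numbering r R \<and> inj r"


type_synonym bitstring = "bool list"

definition string_code :: "bitstring \<Rightarrow> nat" where
  "string_code \<sigma> = list_encode (map of_bool \<sigma>)"

definition computable_on_strings :: "(bitstring \<rightharpoonup> bitstring) \<Rightarrow> bool" where
  "computable_on_strings M \<longleftrightarrow>
     (\<exists>f. partial_recursive f \<and> (\<forall>\<sigma>. f (string_code \<sigma>) = map_option string_code (M \<sigma>)))"

definition prefix_free_machine :: "(bitstring \<rightharpoonup> bitstring) \<Rightarrow> bool" where
  "prefix_free_machine M \<longleftrightarrow>
     computable_on_strings M \<and> (\<forall>\<sigma>\<in>dom M. \<forall>\<tau>\<in>dom M. prefix \<sigma> \<tau> \<longrightarrow> \<sigma> = \<tau>)"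

definition universal_prefix_free_machine :: "(bitstring \<rightharpoonup> bitstring) \<Rightarrow> bool" where
  "universal_prefix_free_machine U \<longleftrightarrow>
     prefix_free_machine U \<and>
     (\<forall>M. prefix_free_machine M \<longrightarrow> (\<exists>\<rho>. \<forall>\<sigma>. U (\<rho> @ \<sigma>) = M \<sigma>))"

(* Complexity with respect to the machine M; it is infinite on strings that M does not output. *)
definition prefix_complexity :: "(bitstring \<rightharpoonup> bitstring) \<Rightarrow> bitstring \<Rightarrow> enat" where
  "prefix_complexity M \<sigma> = (INF \<tau>\<in>{\<tau>. M \<tau> = Some \<sigma>}. enat (length \<tau>))"

definition initial_segment :: "bitseq \<Rightarrow> nat \<Rightarrow> bitstring" where
  "initial_segment x n = map x [0..<n]"

definition martin_loef_random :: "(bitstring \<rightharpoonup> bitstring) \<Rightarrow> bitseq \<Rightarrow> bool" where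
  "martin_loef_random U x \<longleftrightarrow>
     (\<exists>c :: nat. \<forall>n. enat n \<le> prefix_complexity U (initial_segment x n) + enat c)"

end

(* Every index e and every m give a random real: take the supremum of an enumerated set of dyadics
   below 1 - 2^-m and round it up to the next real that avoids all cylinders of strings compressible
   by more than m bits.  By Kraft's inequality the cylinders have measure at most 2^-(m+1), so the
   result is less than 1; the rounding is left-c.e. because a left-c.e. real in a bad cylinder has to
   leave it to the right; and it does not change a real that is random with constant m.  Hence all
   random left-c.e. reals are numbered, with repetitions.  Rounding up 1 - 2^-n similarly yields random
   reals spare_real n in the disjoint intervals [1 - 2^-n, 1 - 2^-(n+1)).  Repetitions are removed as in
   Friedberg's and Kummer's theorems: an index copying a real that looks like a repetition can always be
   diverted, upwards, to a so far unused spare real. *)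

theory Submission
  imports Defs
begin

section \<open>Computable functions\<close>

text \<open>Equality of two left-c.e. reals is a Pi_2 question, so no finite stage reveals a
  repetition. Hence each real is copied by a sequence of followers, one per precision t: agreement
  up to 2^-t, seen at some stage, is a Sigma_1 event. A true repetition triggers it for every t,
  whereas a new real is safe from some t on. Diverting a follower must not lower its value. A dyadic
  below 1 with denominator 2^v is at most 1 - 2^-v. The number n of the spare real taken at stage v
  encodes v, so n >= v, and this spare real is at least 1 - 2^-n. As n records the whole event, the
  spare reals taken by followers form a decidable set, and the index of such a real can be
  reassigned effectively. The spare reals converge to 1, so a real below 1 is close to only finitely
  many of them; otherwise new reals could be diverted forever. Universality of the machine replaces
  a universal partial recursive function: its program prefixes index the c.e. sets.\<close>

abbreviation pfst :: "nat \<Rightarrow> nat" where "pfst n \<equiv> fst (prod_decode n)"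
abbreviation psnd :: "nat \<Rightarrow> nat" where "psnd n \<equiv> snd (prod_decode n)"

text \<open>The argument of a computable function is an environment: bound variables are pushed onto it
  with the pairing function, so that every closure rule below has the shape of an introduction rule.\<close>

definition computable :: "(nat \<Rightarrow> nat) \<Rightarrow> bool" where
  "computable f \<longleftrightarrow> partial_recursive (\<lambda>n. Some (f n))"

definition decidable :: "(nat \<Rightarrow> bool) \<Rightarrow> bool" where
  "decidable P \<longleftrightarrow> computable (\<lambda>n. of_bool (P n))"

named_theorems computable_intros

lemma partial_recursive_compose:
  assumes "partial_recursive f" "computable g"
  shows "partial_recursive (\<lambda>n. f (g n))"
  using partial_recursive.comp[OF assms(1) assms(2)[unfolded computable_def]] by simp

lemma computable_compose:
  assumes "computable f" "computable g"
  shows "computable (\<lambda>n. f (g n))"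
  using partial_recursive_compose[OF assms(1)[unfolded computable_def] assms(2)]
  by (simp add: computable_def)

lemma decidable_compose:
  assumes "decidable P" "computable g"
  shows "decidable (\<lambda>n. P (g n))"
  using computable_compose[OF assms(1)[unfolded decidable_def] assms(2)] by (simp add: decidable_def)

lemma computable_Suc [computable_intros]:
  assumes "computable f" shows "computable (\<lambda>n. Suc (f n))"
  using computable_compose[OF _ assms, of Suc] partial_recursive.succ by (simp add: computable_def)

lemma computable_pfst [computable_intros]:
  assumes "computable f" shows "computable (\<lambda>n. pfst (f n))"
  using computable_compose[OF _ assms, of pfst] partial_recursive.left by (simp add: computable_def)

lemma computable_psnd [computable_intros]:
  assumes "computable f" shows "computable (\<lambda>n. psnd (f n))"
  using computable_compose[OF _ assms, of psnd] partial_recursive.right by (simp add: computable_def)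

lemma computable_prod_encode [computable_intros]:
  assumes "computable f" "computable g" shows "computable (\<lambda>n. prod_encode (f n, g n))"
  using partial_recursive.pair[OF assms[unfolded computable_def]] by (simp add: computable_def)

lemma computable_id [computable_intros]: "computable (\<lambda>n. n)"
  using partial_recursive.pair[OF partial_recursive.left partial_recursive.right]
  by (simp add: computable_def)

lemma computable_const [computable_intros]: "computable (\<lambda>_. c)"
proof (induction c)
  case 0
  show ?case using partial_recursive.zero by (simp add: computable_def)
qed (rule computable_Suc)

text \<open>The step function receives the environment besides counter and previous value, because
  \<open>prec\<close> hands its parameter on; the three arguments are packed as there.\<close>

lemma computable_rec_nat [computable_intros]:
  assumes f: "computable f"
    and g: "computable (\<lambda>z. g (pfst z) (pfst (psnd z)) (psnd (psnd z)))"
    and k: "computable k"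
  shows "computable (\<lambda>n. rec_nat (f n) (g n) (k n))"
proof -
  have *: "rec_nat (Some (f a))
      (\<lambda>m v. Option.bind v (\<lambda>y. Some (g a m y))) j = Some (rec_nat (f a) (g a) j)" for a j
    by (induction j) auto
  have "computable (\<lambda>z. rec_nat (f (pfst z)) (g (pfst z)) (psnd z))"
    using partial_recursive.prec[OF f[unfolded computable_def] g[unfolded computable_def]]
    by (simp add: computable_def case_prod_beta *)
  from computable_compose[OF this computable_prod_encode[OF computable_id k]]
  show ?thesis by simp
qed

lemma computable_pred [computable_intros]:
  assumes "computable f" shows "computable (\<lambda>n. f n - 1)"
proof -
  have "rec_nat 0 (\<lambda>m _. m) k = k - 1" for k by (cases k) auto
  then show ?thesis
    using computable_rec_nat[where f = "\<lambda>_. 0" and g = "\<lambda>_ m _. m", OF _ _ assms]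
    by (simp add: computable_intros)
qed

lemma computable_add [computable_intros]:
  assumes "computable f" "computable g" shows "computable (\<lambda>n. f n + g n)"
proof -
  have "rec_nat a (\<lambda>_ y. Suc y) k = a + k" for a k by (induction k) auto
  then show ?thesis
    using computable_rec_nat[where g = "\<lambda>_ _ y. Suc y", OF assms(1) _ assms(2)]
    by (simp add: computable_intros)
qed

lemma computable_diff [computable_intros]:
  assumes "computable f" "computable g" shows "computable (\<lambda>n. f n - g n)"
proof -
  have "rec_nat a (\<lambda>_ y. y - 1) k = a - k" for a k by (induction k) auto
  then show ?thesis
    using computable_rec_nat[where g = "\<lambda>_ _ y. y - 1", OF assms(1) _ assms(2)]
    by (simp add: computable_intros computable_pred[simplified])
qed

lemma computable_mult [computable_intros]:
  assumes "computable f" "computable g" shows "computable (\<lambda>n. f n * g n)"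
proof -
  have "rec_nat 0 (\<lambda>_ y. y + a) k = a * k" for a k by (induction k) auto
  then show ?thesis
    using computable_rec_nat[where f = "\<lambda>_. 0" and g = "\<lambda>n _ y. y + f n", OF _ _ assms(2)]
    by (simp add: computable_intros computable_compose[OF assms(1)])
qed

lemma computable_power2 [computable_intros]:
  assumes "computable f" shows "computable (\<lambda>n. 2 ^ f n)"
proof -
  have "rec_nat 1 (\<lambda>_ y. 2 * y) k = (2 :: nat) ^ k" for k by (induction k) auto
  then show ?thesis
    using computable_rec_nat[where f = "\<lambda>_. 1" and g = "\<lambda>n _ y. 2 * y", OF _ _ assms]
    by (simp add: computable_intros)
qed

lemma decidable_iff_computable_nonzero:
  "decidable P" if "computable f" "\<And>n. P n \<longleftrightarrow> f n \<noteq> 0"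
proof -
  have "of_bool (P n) = 1 - (1 - f n)" for n using that(2)[of n] by auto
  then show ?thesis
    using that(1) by (simp add: decidable_def computable_intros)
qed

lemma decidable_of_bool [computable_intros]:
  "decidable P \<Longrightarrow> computable (\<lambda>n. of_bool (P n))"
  by (simp add: decidable_def)

lemma decidable_le [computable_intros]:
  assumes "computable f" "computable g" shows "decidable (\<lambda>n. f n \<le> g n)"
  by (rule decidable_iff_computable_nonzero[where f = "\<lambda>n. 1 - (f n - g n)"])
    (auto intro!: computable_intros assms)

lemma decidable_not [computable_intros]:
  assumes "decidable P" shows "decidable (\<lambda>n. \<not> P n)"
  by (rule decidable_iff_computable_nonzero[where f = "\<lambda>n. 1 - of_bool (P n)"])
    (auto intro!: computable_intros assms)

lemma decidable_conj [computable_intros]: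
  assumes "decidable P" "decidable Q" shows "decidable (\<lambda>n. P n \<and> Q n)"
  by (rule decidable_iff_computable_nonzero[where f = "\<lambda>n. of_bool (P n) * of_bool (Q n)"])
    (auto intro!: computable_intros assms)

lemma decidable_disj [computable_intros]:
  assumes "decidable P" "decidable Q" shows "decidable (\<lambda>n. P n \<or> Q n)"
  by (rule decidable_iff_computable_nonzero[where f = "\<lambda>n. of_bool (P n) + of_bool (Q n)"])
    (auto intro!: computable_intros assms)

lemma decidable_imp [computable_intros]:
  assumes "decidable P" "decidable Q" shows "decidable (\<lambda>n. P n \<longrightarrow> Q n)"
  using decidable_disj[OF decidable_not[OF assms(1)] assms(2)] by simp

lemma decidable_less [computable_intros]:
  assumes "computable f" "computable g" shows "decidable (\<lambda>n. f n < g n)"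
  using decidable_not[OF decidable_le[OF assms(2,1)]] by (simp add: not_le)

lemma decidable_eq [computable_intros]:
  assumes "computable f" "computable g" shows "decidable (\<lambda>n. f n = g n)"
  using decidable_conj[OF decidable_le[OF assms] decidable_le[OF assms(2,1)]]
  by (simp add: eq_iff[symmetric])

lemma decidable_bex_less [computable_intros]:
  assumes "computable b" "decidable (\<lambda>z. P (pfst z) (psnd z))"
  shows "decidable (\<lambda>n. \<exists>i<b n. P n i)"
proof (rule decidable_iff_computable_nonzero)
  show "computable (\<lambda>n. rec_nat 0 (\<lambda>m y. y + of_bool (P n m)) (b n))"
    using decidable_compose[OF assms(2),
      OF computable_prod_encode[OF computable_pfst[OF computable_id]
        computable_pfst[OF computable_psnd[OF computable_id]]]]
    by (intro computable_intros assms(1)) simp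
  have "(\<exists>i<k. P n i) \<longleftrightarrow> rec_nat 0 (\<lambda>m y. y + of_bool (P n m)) k \<noteq> (0 :: nat)" for n k
    by (induction k) (auto simp: less_Suc_eq)
  then show "(\<exists>i<b n. P n i) \<longleftrightarrow> rec_nat 0 (\<lambda>m y. y + of_bool (P n m)) (b n) \<noteq> (0 :: nat)" for n .
qed

lemma decidable_bex_le [computable_intros]:
  assumes "computable b" "decidable (\<lambda>z. P (pfst z) (psnd z))"
  shows "decidable (\<lambda>n. \<exists>i\<le>b n. P n i)"
  using decidable_bex_less[OF computable_Suc[OF assms(1)] assms(2)] by (simp add: less_Suc_eq_le)

lemma decidable_ball_less [computable_intros]:
  assumes "computable b" "decidable (\<lambda>z. P (pfst z) (psnd z))"
  shows "decidable (\<lambda>n. \<forall>i<b n. P n i)"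
  using decidable_not[OF decidable_bex_less[OF assms(1) decidable_not[OF assms(2)]]] by simp

lemma decidable_ball_le [computable_intros]:
  assumes "computable b" "decidable (\<lambda>z. P (pfst z) (psnd z))"
  shows "decidable (\<lambda>n. \<forall>i\<le>b n. P n i)"
  using decidable_ball_less[OF computable_Suc[OF assms(1)] assms(2)] by (simp add: less_Suc_eq_le)

lemma computable_if [computable_intros]:
  assumes "decidable P" "computable f" "computable g"
  shows "computable (\<lambda>n. if P n then f n else g n)"
proof -
  have "(if P n then f n else g n) = of_bool (P n) * f n + (1 - of_bool (P n)) * g n" for n by auto
  then show ?thesis by (simp only:) (intro computable_intros assms)
qed

lemma partial_recursive_minimization:
  assumes "decidable (\<lambda>z. P (pfst z) (psnd z))"
  shows "partial_recursive (\<lambda>n. if \<exists>k. P n k then Some (LEAST k. P n k) else None)"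
proof -
  \<comment> \<open>Truth is encoded as 0, since \<open>minim\<close> looks for a zero. The function
    is total, so all earlier values are defined, as \<open>is_first_zero\<close> demands.\<close>
  let ?f = "\<lambda>z. Some (of_bool (\<not> P (pfst z) (psnd z)) :: nat)"
  have f: "partial_recursive ?f"
    using decidable_of_bool[OF decidable_not[OF assms]] by (simp add: computable_def)
  have *: "is_first_zero ?f a n \<longleftrightarrow> P a n \<and> (\<forall>m<n. \<not> P a m)" for a n
    by (auto simp: is_first_zero_def)
  have ex: "(\<exists>n. is_first_zero ?f a n) \<longleftrightarrow> (\<exists>k. P a k)" for a
    unfolding * by (metis LeastI not_less_Least)
  have the: "(THE n. is_first_zero ?f a n) = (LEAST k. P a k)" if "\<exists>k. P a k" for a
    unfolding *
  proof (rule the_equality)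
    show "P a (LEAST k. P a k) \<and> (\<forall>m<LEAST k. P a k. \<not> P a m)"
      using that by (metis LeastI not_less_Least)
    show "n = (LEAST k. P a k)" if "P a n \<and> (\<forall>m<n. \<not> P a m)" for n
      using that by (metis LeastI linorder_neqE_nat not_less_Least)
  qed
  have "(\<lambda>a. if \<exists>n. is_first_zero ?f a n then Some (THE n. is_first_zero ?f a n) else None) =
      (\<lambda>n. if \<exists>k. P n k then Some (LEAST k. P n k) else None)"
    by (rule ext) (use ex the in presburger)
  then show ?thesis using partial_recursive.minim[OF f] by simp
qed

lemma computable_Least:
  assumes "decidable (\<lambda>z. P (pfst z) (psnd z))" "\<And>n. \<exists>k. P n k"
  shows "computable (\<lambda>n. LEAST k. P n k)"
  using partial_recursive_minimization[OF assms(1)] assms(2) by (simp add: computable_def)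

lemma computable_div_power2 [computable_intros]:
  assumes "computable f" "computable g" shows "computable (\<lambda>n. f n div 2 ^ g n)"
proof -
  have *: "a div 2 ^ b = (LEAST q. a < Suc q * 2 ^ b)" for a b :: nat
  proof (rule Least_equality[symmetric])
    show "a < Suc (a div 2 ^ b) * 2 ^ b"
      by (metis dividend_less_div_times mult_Suc zero_less_numeral zero_less_power)
    show "a div 2 ^ b \<le> q" if "a < Suc q * 2 ^ b" for q
      using that by (metis less_Suc_eq_le less_mult_imp_div_less)
  qed
  have "\<exists>q. a < Suc q * 2 ^ b" for a b :: nat
    by (metis dividend_less_div_times mult_Suc zero_less_numeral zero_less_power)
  then show ?thesis
    unfolding * by (intro computable_Least computable_intros computable_compose[OF assms(1)]
      computable_compose[OF assms(2)]) auto
qed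

lemma computable_mod2 [computable_intros]:
  assumes "computable f" shows "computable (\<lambda>n. f n mod 2)"
proof -
  have "f n mod 2 = f n - 2 * (f n div 2 ^ 1)" for n by (simp add: modulo_nat_def)
  then show ?thesis by (simp only:) (intro computable_intros assms)
qed

lemma ce_set_ex:
  assumes "decidable (\<lambda>z. P (pfst z) (psnd z))"
  shows "ce_set {n. \<exists>k. P n k}"
  unfolding ce_set_def using partial_recursive_minimization[OF assms]
  by (intro exI[of _ "\<lambda>n. if \<exists>k. P n k then Some (LEAST k. P n k) else None"]) (auto simp: dom_def)

section \<open>Stage approximations of partial recursive functions\<close>

text \<open>\<open>F n s\<close> is \<open>0\<close> as long as the computation of \<open>f n\<close> has not halted by stage \<open>s\<close>, and
  then \<open>Suc (f n)\<close>.\<close>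

definition stage_approx :: "(nat \<Rightarrow> nat \<Rightarrow> nat) \<Rightarrow> (nat \<rightharpoonup> nat) \<Rightarrow> bool" where
  "stage_approx F f \<longleftrightarrow>
     computable (\<lambda>z. F (pfst z) (psnd z)) \<and>
     (\<forall>n y. f n = Some y \<longleftrightarrow> (\<exists>s. F n s = Suc y)) \<and>
     (\<forall>n s s' y. F n s = Suc y \<longrightarrow> s \<le> s' \<longrightarrow> F n s' = Suc y)"

lemma stage_approx_computable:
  assumes "stage_approx F f" "computable a" "computable b"
  shows "computable (\<lambda>n. F (a n) (b n))"
proof -
  have "computable (\<lambda>z. F (pfst z) (psnd z))"
    using assms(1) unfolding stage_approx_def by blast
  from computable_compose[OF this computable_prod_encode[OF assms(2,3)]] show ?thesis by simp
qed

lemma stage_approx_Some_iff: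
  "stage_approx F f \<Longrightarrow> f n = Some y \<longleftrightarrow> (\<exists>s. F n s = Suc y)"
  unfolding stage_approx_def by blast

lemma stage_approx_sound: "stage_approx F f \<Longrightarrow> F n s = Suc y \<Longrightarrow> f n = Some y"
  unfolding stage_approx_def by blast

lemma stage_approx_mono:
  "stage_approx F f \<Longrightarrow> F n s = Suc y \<Longrightarrow> s \<le> s' \<Longrightarrow> F n s' = Suc y"
  unfolding stage_approx_def by blast

lemma stage_approx_eventually:
  assumes "stage_approx F f" "f n = Some y"
  shows "\<forall>\<^sub>F s in sequentially. F n s = Suc y"
  using assms stage_approx_Some_iff stage_approx_mono unfolding eventually_sequentially by metis

lemma stage_approxI:
  assumes "computable (\<lambda>z. F (pfst z) (psnd z))"
    and sound: "\<And>n s y. F n s = Suc y \<Longrightarrow> f n = Some y"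
    and complete: "\<And>n y. f n = Some y \<Longrightarrow> \<forall>\<^sub>F s in sequentially. F n s = Suc y"
    and mono: "\<And>n s s' y. F n s = Suc y \<Longrightarrow> s \<le> s' \<Longrightarrow> F n s' = Suc y"
  shows "stage_approx F f"
  unfolding stage_approx_def
proof (intro conjI allI impI iffI)
  fix n y assume "f n = Some y"
  from eventually_happens[OF complete[OF this]] show "\<exists>s. F n s = Suc y" by simp
qed (use assms(1) sound mono in blast)+

lemma stage_approx_total:
  assumes "computable f" shows "stage_approx (\<lambda>n _. Suc (f n)) (\<lambda>n. Some (f n))"
  by (rule stage_approxI) (auto intro!: computable_intros computable_compose[OF assms])

lemma stage_approx_pair:
  assumes F: "stage_approx F f" and G: "stage_approx G g"
  shows "stage_approx
    (\<lambda>n s. if F n s = 0 \<or> G n s = 0 then 0 else Suc (prod_encode (F n s - 1, G n s - 1)))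
    (\<lambda>n. Option.bind (f n) (\<lambda>a. Option.bind (g n) (\<lambda>b. Some (prod_encode (a, b)))))"
proof (rule stage_approxI, goal_cases)
  case 1
  show ?case
    by (intro computable_intros stage_approx_computable[OF F] stage_approx_computable[OF G])
next
  case (2 n s y)
  then obtain a b where "F n s = Suc a" "G n s = Suc b" "y = prod_encode (a, b)"
    by (cases "F n s"; cases "G n s") auto
  then show ?case
    using stage_approx_sound[OF F, of n s a] stage_approx_sound[OF G, of n s b] by simp
next
  case (3 n y)
  then obtain a b where "f n = Some a" "g n = Some b" "y = prod_encode (a, b)"
    by (cases "f n"; cases "g n") auto
  then show ?case
    using stage_approx_eventually[OF F, of n a] stage_approx_eventually[OF G, of n b]
    by (auto elim: eventually_elim2)
next
  case (4 n s s' y)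
  then obtain a b where "F n s = Suc a" "G n s = Suc b" "y = prod_encode (a, b)"
    by (cases "F n s"; cases "G n s") auto
  then show ?case
    using 4(2) stage_approx_mono[OF F, of n s a s'] stage_approx_mono[OF G, of n s b s'] by simp
qed

lemma stage_approx_bind:
  assumes F: "stage_approx F f" and G: "stage_approx G g"
  shows "stage_approx (\<lambda>n s. if G n s = 0 then 0 else F (G n s - 1) s) (\<lambda>n. Option.bind (g n) f)"
proof (rule stage_approxI, goal_cases)
  case 1
  show ?case
    by (intro computable_intros stage_approx_computable[OF F] stage_approx_computable[OF G])
next
  case (2 n s y)
  then obtain a where "G n s = Suc a" "F a s = Suc y" by (cases "G n s") auto
  then show ?case
    using stage_approx_sound[OF F, of a s y] stage_approx_sound[OF G, of n s a] by simp
next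
  case (3 n y)
  then obtain a where "g n = Some a" "f a = Some y" by (cases "g n") auto
  then show ?case
    using stage_approx_eventually[OF F, of a y] stage_approx_eventually[OF G, of n a]
    by (auto elim: eventually_elim2)
next
  case (4 n s s' y)
  then obtain a where "G n s = Suc a" "F a s = Suc y" by (cases "G n s") auto
  then show ?case
    using 4(2) stage_approx_mono[OF F, of a s y s'] stage_approx_mono[OF G, of n s a s'] by simp
qed

lemma stage_approx_prec:
  assumes F: "stage_approx F f" and G: "stage_approx G g"
  shows "stage_approx
    (\<lambda>n s. rec_nat (F (pfst n) s)
      (\<lambda>m v. if v = 0 then 0 else G (prod_encode (pfst n, prod_encode (m, v - 1))) s) (psnd n))
    (\<lambda>n. case prod_decode n of (a, k) \<Rightarrow>
      rec_nat (f a) (\<lambda>m v. Option.bind v (\<lambda>y. g (prod_encode (a, prod_encode (m, y))))) k)"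
    (is "stage_approx (\<lambda>n s. ?R n s (psnd n)) _")
proof (rule stage_approxI, goal_cases)
  case 1
  show ?case
    by (intro computable_intros stage_approx_computable[OF F] stage_approx_computable[OF G])
next
  case (2 n s y)
  obtain a k where n: "prod_decode n = (a, k)" by fastforce
  have "rec_nat (f a) (\<lambda>m v. Option.bind v (\<lambda>y. g (prod_encode (a, prod_encode (m, y))))) k = Some y"
    if "?R n s k = Suc y" for k y
    using that
  proof (induction k arbitrary: y)
    case 0
    then show ?case using stage_approx_sound[OF F] n by simp
  next
    case (Suc k)
    then obtain v where "?R n s k = Suc v" by (cases "?R n s k") auto
    with Suc show ?case
      using stage_approx_sound[OF G, of "prod_encode (a, prod_encode (k, v))" s y] n by simp
  qed
  with 2 show ?case by (simp add: n)
next
  case (3 n y)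
  obtain a k where n: "prod_decode n = (a, k)" by fastforce
  have "\<forall>\<^sub>F s in sequentially. ?R n s k = Suc y"
    if "rec_nat (f a) (\<lambda>m v. Option.bind v (\<lambda>y. g (prod_encode (a, prod_encode (m, y))))) k = Some y"
    for k y
    using that
  proof (induction k arbitrary: y)
    case 0
    then show ?case using stage_approx_eventually[OF F] n by auto
  next
    case (Suc k)
    then obtain v where v: "g (prod_encode (a, prod_encode (k, v))) = Some y"
      "\<forall>\<^sub>F s in sequentially. ?R n s k = Suc v"
      by (auto simp: bind_eq_Some_conv)
    then show ?case
      using stage_approx_eventually[OF G v(1)] n by (auto elim: eventually_elim2)
  qed
  with 3 show ?case by (simp add: n)
next
  case (4 n s s' y)
  have "?R n s' k = Suc y" if "?R n s k = Suc y" for k y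
    using that
  proof (induction k arbitrary: y)
    case 0
    then show ?case using stage_approx_mono[OF F _ 4(2)] by simp
  next
    case (Suc k)
    then obtain v where "?R n s k = Suc v" by (cases "?R n s k") auto
    with Suc show ?case
      using stage_approx_mono[OF G _ 4(2), of "prod_encode (pfst n, prod_encode (k, v))" y] by simp
  qed
  with 4 show ?case by blast
qed

text \<open>A stage value 0 means pending, 1 means result 0, and 2 or more a positive result. So
  \<open>H a s\<close> is the first \<open>n\<close> not yet seen to be positive, and the search has
  succeeded if it is at most \<open>s\<close> and has stage value 1. The alternative
  \<open>s < n\<close> ensures that the least number exists.\<close>

lemma stage_approx_minim:
  assumes F: "stage_approx F f"
  defines "H \<equiv> \<lambda>a s. LEAST n. s < n \<or> F (prod_encode (a, n)) s < 2"
  shows "stage_approx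
    (\<lambda>a s. if H a s \<le> s \<and> F (prod_encode (a, H a s)) s = 1 then Suc (H a s) else 0)
    (\<lambda>a. if \<exists>n. is_first_zero f a n then Some (THE n. is_first_zero f a n) else None)"
proof -
  define C where "C = (\<lambda>a s n. n \<le> s \<and> F (prod_encode (a, n)) s = 1 \<and>
    (\<forall>m<n. 2 \<le> F (prod_encode (a, m)) s))"
  have H_ge: "n \<le> H a s" if C: "C a s n" for a s n
  proof (rule ccontr)
    assume "\<not> n \<le> H a s"
    moreover have "s < H a s \<or> F (prod_encode (a, H a s)) s < 2"
      unfolding H_def by (rule LeastI_ex) (blast intro: lessI)
    ultimately show False using C by (auto simp: C_def dest: spec[of _ "H a s"])
  qed
  have C_iff: "(if H a s \<le> s \<and> F (prod_encode (a, H a s)) s = 1 then Suc (H a s) else 0) = Suc n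
      \<longleftrightarrow> C a s n" for a s n
  proof
    assume l: "(if H a s \<le> s \<and> F (prod_encode (a, H a s)) s = 1 then Suc (H a s) else 0) = Suc n"
    have "2 \<le> F (prod_encode (a, m)) s" if "m < H a s" for m
      using not_less_Least[OF that[unfolded H_def]] by simp
    with l show "C a s n" by (auto simp: C_def split: if_splits)
  next
    assume C: "C a s n"
    then have "H a s \<le> n" unfolding H_def C_def by (intro Least_le) auto
    with H_ge[OF C] have "H a s = n" by simp
    with C show "(if H a s \<le> s \<and> F (prod_encode (a, H a s)) s = 1 then Suc (H a s) else 0) = Suc n"
      by (auto simp: C_def)
  qed
  have sound: "is_first_zero f a n" if "C a s n" for a s n
    unfolding is_first_zero_def
  proof (intro conjI allI impI)
    show "f (prod_encode (a, n)) = Some 0"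
      using that stage_approx_sound[OF F, of _ s] unfolding C_def by auto
    fix m assume "m < n"
    with that have "2 \<le> F (prod_encode (a, m)) s" by (simp add: C_def)
    then have "F (prod_encode (a, m)) s = Suc (Suc (F (prod_encode (a, m)) s - 2))" by simp
    then show "\<exists>y. f (prod_encode (a, m)) = Some (Suc y)"
      using stage_approx_sound[OF F] by blast
  qed
  have complete: "\<forall>\<^sub>F s in sequentially. C a s n" if "is_first_zero f a n" for a n
  proof -
    have "\<forall>\<^sub>F s in sequentially. 2 \<le> F (prod_encode (a, m)) s" if "m \<in> {..<n}" for m
    proof -
      obtain y where "f (prod_encode (a, m)) = Some (Suc y)"
        using \<open>is_first_zero f a n\<close> \<open>m \<in> {..<n}\<close> by (auto simp: is_first_zero_def)
      from stage_approx_eventually[OF F this] show ?thesis by eventually_elim simp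
    qed
    then have "\<forall>\<^sub>F s in sequentially. \<forall>m\<in>{..<n}. 2 \<le> F (prod_encode (a, m)) s"
      by (simp add: eventually_ball_finite)
    moreover have "\<forall>\<^sub>F s in sequentially. F (prod_encode (a, n)) s = Suc 0"
      using that stage_approx_eventually[OF F] by (simp add: is_first_zero_def)
    moreover have "\<forall>\<^sub>F s in sequentially. n \<le> s" by (rule eventually_ge_at_top)
    ultimately show ?thesis by eventually_elim (auto simp: C_def)
  qed
  have unique: "n = n'" if "is_first_zero f a n" "is_first_zero f a n'" for a n n'
    using that unfolding is_first_zero_def
    by (metis linorder_neqE_nat nat.distinct(1) option.inject)
  have the: "(THE n. is_first_zero f a n) = n" if "is_first_zero f a n" for a n
    using that unique by blast
  show ?thesis
  proof (rule stage_approxI, goal_cases)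
    case 1
    have "\<exists>n. psnd z < n \<or> F (prod_encode (pfst z, n)) (psnd z) < 2" for z by blast
    then have "computable (\<lambda>z. H (pfst z) (psnd z))" unfolding H_def
      by (intro computable_Least computable_intros stage_approx_computable[OF F])
    then show ?case
      by (intro computable_intros stage_approx_computable[OF F])
  next
    case (2 a s n)
    with sound the show ?case unfolding C_iff by auto
  next
    case (3 a n)
    with complete the show ?case unfolding C_iff by (auto split: if_splits)
  next
    case (4 a s s' n)
    have "2 \<le> F (prod_encode (a, m)) s'" if "2 \<le> F (prod_encode (a, m)) s" for m
      using stage_approx_mono[OF F _ 4(2), of "prod_encode (a, m)" "F (prod_encode (a, m)) s - 1"] that
      by simp
    moreover from 4(1) have C: "C a s n" unfolding C_iff .
    moreover from C have "F (prod_encode (a, n)) s = Suc 0" by (simp add: C_def)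
    from stage_approx_mono[OF F this 4(2)] have "F (prod_encode (a, n)) s' = Suc 0" .
    ultimately have "C a s' n" using 4(2) by (simp add: C_def)
    then show ?case unfolding C_iff .
  qed
qed

text \<open>\<open>partial_recursive\<close> carries no notion of computation step. Induction on the
  derivation supplies one, and with it a decidable view of what has halted by a given stage.\<close>

theorem ex_stage_approx:
  assumes "partial_recursive f" shows "\<exists>F. stage_approx F f"
  using assms
proof induction
  case zero
  show ?case by (rule exI, rule stage_approx_total) (intro computable_intros)
next
  case succ
  show ?case by (rule exI, rule stage_approx_total) (intro computable_intros)
next
  case left
  show ?case by (rule exI, rule stage_approx_total) (intro computable_intros)
next
  case right
  show ?case by (rule exI, rule stage_approx_total) (intro computable_intros)
qed (blast intro: stage_approx_pair stage_approx_bind stage_approx_prec stage_approx_minim)+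

section \<open>Bit strings\<close>

text \<open>Binary numeral with \<open>n\<close> digits, most significant first. For
  \<open>j < 2 ^ n\<close> its cylinder is the interval from \<open>j / 2^n\<close> to
  \<open>(j + 1) / 2^n\<close>.\<close>

primrec bin :: "nat \<Rightarrow> nat \<Rightarrow> bitstring" where
  "bin 0 j = []"
| "bin (Suc n) j = odd (j div 2 ^ n) # bin n j"

lemma length_bin [simp]: "length (bin n j) = n"
  by (induction n) auto

lemma nth_bin: "i < n \<Longrightarrow> bin n j ! i = odd (j div 2 ^ (n - 1 - i))"
  by (induction n arbitrary: i) (auto simp: nth_Cons' less_Suc_eq_0_disj)

lemma take_bin: "n \<le> s \<Longrightarrow> take n (bin s k) = bin n (k div 2 ^ (s - n))"
  by (rule nth_equalityI)
    (auto simp: nth_bin div_mult2_eq[symmetric] power_add[symmetric] simp flip: div_mult2_eq)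

lemma bin_Suc: "bin (Suc n) j = bin n (j div 2) @ [odd j]"
  by (induction n arbitrary: j) (auto simp: div_mult2_eq)

text \<open>In terms of intervals, this is the rightmost piece of length 2^-(n+k) in the cylinder of
  \<open>bin n j\<close>. Approximations strictly increasing to its right endpoint end up
  there.\<close>

lemma bin_ones: "bin (n + k) (j * 2 ^ k + (2 ^ k - 1)) = bin n j @ replicate k True"
proof (induction k)
  case (Suc k)
  have "j * 2 ^ Suc k + (2 ^ Suc k - 1) = Suc (2 * (j * 2 ^ k + (2 ^ k - 1)))"
  proof -
    obtain p where "2 ^ k = Suc p" using not0_implies_Suc[of "2 ^ k"] by auto
    then show ?thesis by (simp add: algebra_simps)
  qed
  with Suc show ?case
    by (simp add: bin_Suc replicate_append_same del: bin.simps power_Suc)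
qed simp

lemma inj_on_bin: "inj_on (bin n) {..<2 ^ n}"
proof (rule inj_onI)
  fix j k :: nat
  assume jk: "j \<in> {..<2 ^ n}" "k \<in> {..<2 ^ n}" "bin n j = bin n k"
  have "bit j i = bit k i" for i
  proof (cases "i < n")
    case True
    then have "bin n j ! (n - 1 - i) = bin n k ! (n - 1 - i)" using jk by simp
    with True show ?thesis by (simp add: nth_bin bit_iff_odd)
  next
    case False
    then have "(2 :: nat) ^ n \<le> 2 ^ i" by (simp add: power_increasing)
    with jk(1,2) have "j < 2 ^ i" "k < 2 ^ i" by (metis lessThan_iff order_less_le_trans)+
    then show ?thesis by (simp add: bit_iff_odd)
  qed
  then show "j = k" by (simp add: bit_eq_iff)
qed

lemma card_bitstrings: "card {\<sigma> :: bitstring. length \<sigma> = n} = 2 ^ n"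
  using card_lists_length_eq[of "UNIV :: bool set" n] by simp

lemma finite_bitstrings: "finite {\<sigma> :: bitstring. length \<sigma> = n}"
  using finite_lists_length_eq[of "UNIV :: bool set" n] by simp

lemma bij_betw_bin: "bij_betw (bin n) {..<2 ^ n} {\<sigma>. length \<sigma> = n}"
proof -
  have "bin n ` {..<2 ^ n} = {\<sigma>. length \<sigma> = n}"
    by (rule card_subset_eq[OF finite_bitstrings])
      (auto simp: card_bitstrings card_image[OF inj_on_bin])
  then show ?thesis using inj_on_bin by (simp add: bij_betw_def)
qed

lemma ex_bin: "\<exists>j<2 ^ length \<sigma>. \<sigma> = bin (length \<sigma>) j"
proof -
  have "\<sigma> \<in> bin (length \<sigma>) ` {..<2 ^ length \<sigma>}"
    by (simp add: bij_betw_imp_surj_on[OF bij_betw_bin])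
  then show ?thesis by blast
qed

lemma card_prefix_extensions:
  assumes "length \<sigma> \<le> s"
  shows "card {\<tau> :: bitstring. length \<tau> = s \<and> prefix \<sigma> \<tau>} = 2 ^ (s - length \<sigma>)"
proof -
  have "{\<tau>. length \<tau> = s \<and> prefix \<sigma> \<tau>} = (@) \<sigma> ` {\<tau>. length \<tau> = s - length \<sigma>}"
    using assms by (auto simp: prefix_def image_iff)
  then show ?thesis by (simp add: card_image inj_on_def card_bitstrings)
qed

text \<open>Taken at a finite level \<open>s\<close> to stay in the natural numbers: each string of
  \<open>T\<close> owns its extensions of length \<open>s\<close>, and prefix-freeness makes these
  sets disjoint.\<close>

lemma Kraft_inequality:
  fixes T :: "bitstring set"
  assumes "finite T" "\<And>\<tau>. \<tau> \<in> T \<Longrightarrow> length \<tau> \<le> s"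
    and pf: "\<And>\<sigma> \<tau>. \<sigma> \<in> T \<Longrightarrow> \<tau> \<in> T \<Longrightarrow> prefix \<sigma> \<tau> \<Longrightarrow> \<sigma> = \<tau>"
  shows "(\<Sum>\<tau>\<in>T. 2 ^ (s - length \<tau>)) \<le> (2 :: nat) ^ s"
proof -
  let ?E = "\<lambda>\<sigma>. {\<tau> :: bitstring. length \<tau> = s \<and> prefix \<sigma> \<tau>}"
  have fin: "finite (?E \<sigma>)" for \<sigma>
    by (rule finite_subset[OF _ finite_bitstrings[of s]]) auto
  have "(\<Sum>\<tau>\<in>T. 2 ^ (s - length \<tau>)) = (\<Sum>\<tau>\<in>T. card (?E \<tau>))"
    by (intro sum.cong refl card_prefix_extensions[symmetric] assms(2))
  also have "\<dots> = card (\<Union>\<tau>\<in>T. ?E \<tau>)"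
  proof (intro card_UN_disjoint[symmetric] assms(1) ballI fin impI)
    fix \<sigma> \<tau> assume "\<sigma> \<in> T" "\<tau> \<in> T" "\<sigma> \<noteq> \<tau>"
    then have "\<not> prefix \<sigma> \<tau>" "\<not> prefix \<tau> \<sigma>" using pf by metis+
    then show "?E \<sigma> \<inter> ?E \<tau> = {}" using prefix_same_cases by blast
  qed
  also have "\<dots> \<le> card {\<tau> :: bitstring. length \<tau> = s}"
    by (intro card_mono finite_bitstrings) auto
  finally show ?thesis by (simp add: card_bitstrings)
qed

section \<open>Numerical codes of strings\<close>

lemma inj_string_code: "inj string_code"
proof (rule injI)
  fix \<sigma> \<tau> assume "string_code \<sigma> = string_code \<tau>"
  then have "map of_bool \<sigma> = (map of_bool \<tau> :: nat list)"
    unfolding string_code_def using inj_list_encode by (metis injD)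
  moreover have "inj (of_bool :: bool \<Rightarrow> nat)" by (auto simp: inj_def)
  ultimately show "\<sigma> = \<tau>" by (simp add: inj_map_eq_map)
qed

lemma string_code_eq_iff [simp]: "string_code \<sigma> = string_code \<tau> \<longleftrightarrow> \<sigma> = \<tau>"
  using inj_string_code by (auto dest: injD)

lemma string_code_simps:
  "string_code [] = 0"
  "string_code (b # \<sigma>) = Suc (prod_encode (of_bool b, string_code \<sigma>))"
  by (simp_all add: string_code_def)

text \<open>Prepends \<open>bin n j\<close> to the string with code \<open>c\<close>. The last
  recursion step is outermost, so bits are taken from the least significant upwards.\<close>

definition bin_code :: "nat \<Rightarrow> nat \<Rightarrow> nat \<Rightarrow> nat" where
  "bin_code n j c = rec_nat c (\<lambda>m y. Suc (prod_encode ((j div 2 ^ m) mod 2, y))) n"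

lemma bin_code_string_code: "bin_code n j (string_code \<sigma>) = string_code (bin n j @ \<sigma>)"
  by (induction n) (auto simp: bin_code_def string_code_simps mod_2_eq_odd)

lemma bin_code_0: "bin_code n j 0 = string_code (bin n j)"
  using bin_code_string_code[of n j "[]"] by (simp add: string_code_simps)

lemma computable_bin_code [computable_intros]:
  assumes "computable f" "computable g" "computable h"
  shows "computable (\<lambda>z. bin_code (f z) (g z) (h z))"
  unfolding bin_code_def by (intro computable_intros assms computable_compose[OF assms(2)])

section \<open>Self-delimiting numerals and consequences of universality\<close>

definition unary :: "nat \<Rightarrow> bitstring" where
  "unary k = replicate k True @ [False]"

definition unary_code :: "nat \<Rightarrow> nat" where
  "unary_code k = rec_nat (Suc (prod_encode (0, 0))) (\<lambda>_ y. Suc (prod_encode (1, y))) k"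

lemma unary_code_eq: "unary_code k = string_code (unary k)"
  by (induction k) (auto simp: unary_code_def unary_def string_code_simps)

lemma computable_unary_code [computable_intros]:
  assumes "computable f" shows "computable (\<lambda>z. unary_code (f z))"
  unfolding unary_code_def by (intro computable_intros assms)

lemma length_unary [simp]: "length (unary k) = Suc k"
  by (simp add: unary_def)

lemma prefix_unary:
  assumes "prefix (unary a) (unary b)" shows "a = b"
proof (rule ccontr)
  assume "a \<noteq> b"
  moreover have "a \<le> b" using prefix_length_le[OF assms] by simp
  ultimately have "a < b" by simp
  from assms obtain \<tau> where "unary b = unary a @ \<tau>" by (auto simp: prefix_def)
  then have "unary b ! a = (unary a @ \<tau>) ! a" by simp
  with \<open>a < b\<close> show False by (simp add: unary_def nth_append)
qed

text \<open>The strings \<open>unary k\<close> form a prefix-free set, so any partial recursive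
  function from numbers to strings becomes a prefix-free machine, which \<open>U\<close> simulates
  at the cost of a fixed prefix.\<close>

lemma universal_unary_machine:
  assumes U: "universal_prefix_free_machine U"
    and g: "partial_recursive g" "\<And>k. g k = map_option string_code (h k)"
  shows "\<exists>\<rho>. \<forall>k. U (\<rho> @ unary k) = h k"
proof -
  define M where "M = (\<lambda>\<sigma>. if \<exists>k. \<sigma> = unary k then h (LEAST k. \<sigma> = unary k) else None)"
  have M_unary: "M (unary k) = h k" for k
  proof -
    have "(LEAST j. unary k = unary j) = k"
      by (rule Least_equality) (auto dest: arg_cong[of _ _ length])
    then show ?thesis by (auto simp: M_def)
  qed
  define f where "f = (\<lambda>c. if \<exists>k. c = unary_code k then Some (LEAST k. c = unary_code k) else None)"
  have "partial_recursive f"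
    unfolding f_def by (intro partial_recursive_minimization computable_intros)
  from partial_recursive.comp[OF g(1) this]
  have pr: "partial_recursive (\<lambda>c. Option.bind (f c) g)" .
  have "Option.bind (f (string_code \<sigma>)) g = map_option string_code (M \<sigma>)" for \<sigma>
    by (auto simp: f_def M_def unary_code_eq g(2))
  with pr have "computable_on_strings M" unfolding computable_on_strings_def by blast
  moreover have "\<exists>k. \<sigma> = unary k" if "\<sigma> \<in> dom M" for \<sigma>
    using that by (auto simp: M_def split: if_splits)
  then have "\<forall>\<sigma>\<in>dom M. \<forall>\<tau>\<in>dom M. prefix \<sigma> \<tau> \<longrightarrow> \<sigma> = \<tau>"
    using prefix_unary by metis
  ultimately have "prefix_free_machine M" by (simp add: prefix_free_machine_def)
  with U obtain \<rho> where "\<forall>\<sigma>. U (\<rho> @ \<sigma>) = M \<sigma>"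
    unfolding universal_prefix_free_machine_def by blast
  then show ?thesis by (intro exI[of _ \<rho>]) (simp add: M_unary)
qed

text \<open>A block of \<open>2 * k\<close> ones has a description of about \<open>k\<close> bits,
  so long blocks save any given number of bits. This rules out random sequences ending in ones, and
  rounded approximations that strictly increase to a dyadic.\<close>

lemma ones_compressible:
  assumes U: "universal_prefix_free_machine U"
  shows "\<exists>k \<tau>. U \<tau> = Some (\<sigma> @ replicate k True) \<and> length \<tau> + c < length \<sigma> + k"
proof -
  obtain j where \<sigma>: "\<sigma> = bin (length \<sigma>) j" using ex_bin by blast
  define g where "g = (\<lambda>k. bin_code (length \<sigma>) j (rec_nat 0 (\<lambda>_ y. Suc (prod_encode (1, y))) (2 * k)))"
  have "computable g" unfolding g_def by (intro computable_intros)
  then have "partial_recursive (\<lambda>k. Some (g k))" by (simp add: computable_def)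
  moreover have "rec_nat 0 (\<lambda>_ y. Suc (prod_encode (1, y))) k = string_code (replicate k True)" for k
    by (induction k) (auto simp: string_code_simps)
  then have "g k = string_code (\<sigma> @ replicate (2 * k) True)" for k
    unfolding g_def using \<sigma> by (simp add: bin_code_string_code)
  ultimately obtain \<rho> where \<rho>: "\<And>k. U (\<rho> @ unary k) = Some (\<sigma> @ replicate (2 * k) True)"
    using universal_unary_machine[OF U, of "\<lambda>k. Some (g k)" "\<lambda>k. Some (\<sigma> @ replicate (2 * k) True)"]
    by auto
  \<comment> \<open>The description has \<open>length \<rho> + ?k + 1\<close> bits and the output
    \<open>length \<sigma> + 2 * ?k\<close>; so it suffices that \<open>?k\<close> exceeds
    \<open>length \<rho> + 1 + c\<close>.\<close>
  let ?k = "length \<rho> + c + 2"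
  show ?thesis
    by (rule exI[of _ "2 * ?k"], rule exI[of _ "\<rho> @ unary ?k"]) (simp add: \<rho>)
qed

text \<open>\<open>U\<close> serves as universal enumeration of the c.e. sets, with two numbers
  \<open>l\<close> and \<open>i\<close> as index in place of a string.\<close>

lemma ce_set_universal:
  assumes U: "universal_prefix_free_machine U" and "ce_set A"
  shows "\<exists>l i. \<forall>n. n \<in> A \<longleftrightarrow> U (bin l i @ unary n) \<noteq> None"
proof -
  obtain f where f: "partial_recursive f" "dom f = A" using assms(2) by (auto simp: ce_set_def)
  \<comment> \<open>Only the domain matters; the output is made constant because values of
    \<open>f\<close> need not be codes of strings.\<close>
  have "partial_recursive (\<lambda>n. Option.bind (f n) (\<lambda>_. Some 0))"
    by (rule partial_recursive.comp[OF partial_recursive.zero f(1)])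
  moreover have "Option.bind (f n) (\<lambda>_. Some 0) =
      map_option string_code (if n \<in> A then Some [] else None)" for n
    using f(2) by (cases "f n") (auto simp: string_code_simps dom_def)
  ultimately obtain \<rho> where \<rho>: "\<And>n. U (\<rho> @ unary n) = (if n \<in> A then Some [] else None)"
    using universal_unary_machine[OF U, of "\<lambda>n. Option.bind (f n) (\<lambda>_. Some 0)"
      "\<lambda>n. if n \<in> A then Some [] else None"] by blast
  moreover obtain i where "\<rho> = bin (length \<rho>) i" using ex_bin by blast
  ultimately show ?thesis by (metis option.distinct(1))
qed

section \<open>Reals and their binary expansions\<close>

text \<open>For \<open>a\<close> in [0, 1) this is the binary expansion that does not end in
  ones.\<close>

definition bits :: "real \<Rightarrow> bitseq" where
  "bits a i = odd (nat \<lfloor>a * 2 ^ Suc i\<rfloor>)"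

lemma nat_floor_div_power2: "nat \<lfloor>a * 2 ^ s\<rfloor> div 2 ^ (s - n) = nat \<lfloor>a * 2 ^ n\<rfloor>"
  if "n \<le> s" "0 \<le> a" for a :: real
proof -
  have "(2 :: real) ^ s = 2 ^ (s - n) * 2 ^ n" using that by (simp flip: power_add)
  then have "a * 2 ^ n = a * 2 ^ s / real_of_int (2 ^ (s - n))" by simp
  then have "\<lfloor>a * 2 ^ n\<rfloor> = \<lfloor>a * 2 ^ s\<rfloor> div 2 ^ (s - n)"
    by (metis floor_divide_real_eq_div of_int_power zero_le_numeral zero_le_power)
  then show ?thesis using that by (simp add: nat_div_distrib nat_power_eq)
qed

lemma initial_segment_bits:
  assumes "0 \<le> a" shows "initial_segment (bits a) n = bin n (nat \<lfloor>a * 2 ^ n\<rfloor>)"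
proof (rule nth_equalityI)
  fix i assume "i < length (initial_segment (bits a) n)"
  then have "i < n" by (simp add: initial_segment_def)
  then show "initial_segment (bits a) n ! i = bin n (nat \<lfloor>a * 2 ^ n\<rfloor>) ! i"
    using nat_floor_div_power2[of "Suc i" n a] assms
    by (simp add: initial_segment_def nth_bin bits_def)
qed (simp add: initial_segment_def)

lemma summable_bitseq: "summable (\<lambda>i. of_bool (x i) / 2 ^ (i + 1) :: real)"
proof (rule summable_comparison_test')
  show "summable (\<lambda>i. (1 / 2) ^ (i + 1) :: real)" by (simp add: summable_geometric)
  show "norm (of_bool (x i) / 2 ^ (i + 1) :: real) \<le> (1 / 2) ^ (i + 1)" for i
    by (simp add: power_divide divide_simps)
qed

lemma real_of_bitseq_bits:
  assumes "0 \<le> a" "a < 1" shows "real_of_bitseq (bits a) = a"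
proof -
  have sum: "(\<Sum>i<n. of_bool (bits a i) / 2 ^ (i + 1)) = real (nat \<lfloor>a * 2 ^ n\<rfloor>) / 2 ^ n" for n
  proof (induction n)
    case 0
    have "\<lfloor>a\<rfloor> = 0" using assms by linarith
    then show ?case by simp
  next
    case (Suc n)
    let ?k = "nat \<lfloor>a * 2 ^ Suc n\<rfloor>"
    have "?k div 2 = nat \<lfloor>a * 2 ^ n\<rfloor>" using nat_floor_div_power2[of n "Suc n" a] assms by simp
    moreover have "real k = 2 * real (k div 2) + of_bool (odd k)" for k
      by (cases "even k") (auto elim!: evenE oddE)
    ultimately have "real ?k = 2 * real (nat \<lfloor>a * 2 ^ n\<rfloor>) + of_bool (bits a n)"
      unfolding bits_def by metis
    with Suc show ?case by (simp add: field_simps)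
  qed
  have "(\<lambda>n. real (nat \<lfloor>a * 2 ^ n\<rfloor>) / 2 ^ n) \<longlonglongrightarrow> a"
  proof (rule tendsto_sandwich[of "\<lambda>n. a - (1 / 2) ^ n" _ _ "\<lambda>_. a"])
    have floor: "real (nat \<lfloor>a * 2 ^ n\<rfloor>) \<le> a * 2 ^ n" "a * 2 ^ n - 1 \<le> real (nat \<lfloor>a * 2 ^ n\<rfloor>)" for n
      using assms by (simp_all add: of_nat_nat)
    have "real (nat \<lfloor>a * 2 ^ n\<rfloor>) / 2 ^ n \<le> a" "a - (1 / 2) ^ n \<le> real (nat \<lfloor>a * 2 ^ n\<rfloor>) / 2 ^ n" for n
      using floor(1)[of n] divide_right_mono[OF floor(2)[of n], of "2 ^ n"]
      by (simp_all add: divide_le_eq diff_divide_distrib power_one_over)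
    then show "\<forall>\<^sub>F n in sequentially. a - (1 / 2) ^ n \<le> real (nat \<lfloor>a * 2 ^ n\<rfloor>) / 2 ^ n"
      "\<forall>\<^sub>F n in sequentially. real (nat \<lfloor>a * 2 ^ n\<rfloor>) / 2 ^ n \<le> a"
      by simp_all
    show "(\<lambda>n. a - (1 / 2) ^ n) \<longlonglongrightarrow> a"
      using tendsto_diff[OF tendsto_const LIMSEQ_power_zero[of "1 / 2 :: real"]] by simp
  qed simp
  then have "(\<lambda>i. of_bool (bits a i) / 2 ^ (i + 1)) sums a"
    unfolding sums_def sum .
  then show ?thesis unfolding real_of_bitseq_def by (simp add: sums_iff)
qed

text \<open>A later \<open>False\<close> keeps every tail strictly below 2^-n, so the first
  \<open>n\<close> bits give the floor of the scaled value; after a tail of ones the floor would be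
  one larger.\<close>

lemma bitseq_eq_bits:
  assumes "\<And>n. \<exists>i\<ge>n. \<not> x i"
  shows "0 \<le> real_of_bitseq x" "real_of_bitseq x < 1" "bits (real_of_bitseq x) = x"
proof -
  let ?t = "\<lambda>i. of_bool (x i) / 2 ^ (i + 1) :: real"
  let ?a = "real_of_bitseq x"
  have tail: "0 \<le> (\<Sum>i. ?t (i + n)) \<and> (\<Sum>i. ?t (i + n)) < 1 / 2 ^ n" for n
  proof
    have s: "summable (\<lambda>i. ?t (i + n))" by (rule summable_ignore_initial_segment[OF summable_bitseq])
    show "0 \<le> (\<Sum>i. ?t (i + n))" by (rule suminf_nonneg[OF s]) simp
    have g: "(\<lambda>i. (1 / 2) ^ n * (1 / 2) ^ Suc i) sums ((1 / 2) ^ n * 1 :: real)"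
      by (rule sums_mult[OF power_half_series])
    obtain j where j: "j \<ge> n" "\<not> x j" using assms by blast
    let ?d = "\<lambda>i. (1 / 2) ^ n * (1 / 2) ^ Suc i - ?t (i + n)"
    have "0 < suminf ?d"
    proof (rule suminf_pos2)
      show "summable ?d" by (rule summable_diff[OF sums_summable[OF g] s])
      show "0 \<le> ?d i" for i by (simp add: power_divide power_add divide_simps)
      show "0 < ?d (j - n)" using j by simp
    qed
    then have "(\<Sum>i. ?t (i + n)) < (\<Sum>i. (1 / 2) ^ n * (1 / 2) ^ Suc i)"
      by (simp only: suminf_diff[OF sums_summable[OF g] s, symmetric])
    also have "\<dots> = 1 / 2 ^ n" using g by (simp add: sums_iff power_divide)
    finally show "(\<Sum>i. ?t (i + n)) < 1 / 2 ^ n" .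
  qed
  have split: "?a = (\<Sum>i. ?t (i + n)) + (\<Sum>i<n. ?t i)" for n
    unfolding real_of_bitseq_def by (rule suminf_split_initial_segment[OF summable_bitseq])
  define N where "N = rec_nat 0 (\<lambda>i y. 2 * y + of_bool (x i) :: nat)"
  have N: "real (N n) = (\<Sum>i<n. ?t i) * 2 ^ n" for n
    by (induction n) (auto simp: N_def field_simps)
  have floor: "nat \<lfloor>?a * 2 ^ n\<rfloor> = N n" for n
  proof -
    have "?a * 2 ^ n = (\<Sum>i. ?t (i + n)) * 2 ^ n + real (N n)"
      using split[of n] N[of n] by (simp add: algebra_simps)
    then have "real (N n) \<le> ?a * 2 ^ n" "?a * 2 ^ n < real (N n) + 1"
      using tail[of n] by (simp_all add: field_simps)
    then have "\<lfloor>?a * 2 ^ n\<rfloor> = int (N n)" by (intro floor_unique) auto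
    then show ?thesis by simp
  qed
  show "0 \<le> ?a" "?a < 1" using split[of 0] tail[of 0] by auto
  show "bits ?a = x" unfolding bits_def floor by (auto simp: N_def)
qed

lemma martin_loef_random_iff:
  "martin_loef_random U x \<longleftrightarrow>
     (\<exists>c. \<forall>n \<tau>. U \<tau> = Some (initial_segment x n) \<longrightarrow> n \<le> length \<tau> + c)"
proof -
  have "enat n \<le> prefix_complexity U (initial_segment x n) + enat c \<longleftrightarrow>
     (\<forall>\<tau>. U \<tau> = Some (initial_segment x n) \<longrightarrow> n \<le> length \<tau> + c)" for n c
  proof -
    let ?T = "{\<tau>. U \<tau> = Some (initial_segment x n)}"
    have "enat n \<le> (INF \<tau>\<in>?T. enat (length \<tau>)) + enat c \<longleftrightarrow> (\<forall>\<tau>\<in>?T. n \<le> length \<tau> + c)"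
    proof (cases "?T = {}")
      case True
      then show ?thesis by (simp add: top_enat_def)
    next
      case False
      then have "(INF \<tau>\<in>?T. enat (length \<tau>)) \<in> (\<lambda>\<tau>. enat (length \<tau>)) ` ?T"
        by (metis (no_types, lifting) image_is_empty wellorder_InfI Inf_enat_def ex_in_conv LeastI)
      then obtain \<tau> where \<tau>: "\<tau> \<in> ?T" "(INF \<tau>\<in>?T. enat (length \<tau>)) = enat (length \<tau>)" by auto
      moreover have "length \<tau> \<le> length \<tau>'" if "\<tau>' \<in> ?T" for \<tau>'
        using INF_lower[OF that, of "\<lambda>\<tau>. enat (length \<tau>)"] \<tau>(2) by simp
      ultimately show ?thesis by force
    qed
    then show ?thesis by (simp add: prefix_complexity_def)
  qed
  then show ?thesis by (simp add: martin_loef_random_def)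
qed

text \<open>Appending ones is cheap by \<open>ones_compressible\<close>. Consequently
  \<open>bits\<close> recovers a random sequence from its real value.\<close>

lemma random_not_eventually_true:
  assumes U: "universal_prefix_free_machine U" and x: "martin_loef_random U x"
  shows "\<exists>i\<ge>n. \<not> x i"
proof (rule ccontr)
  assume "\<not> (\<exists>i\<ge>n. \<not> x i)"
  then have tr: "x i" if "i \<ge> n" for i using that by blast
  obtain c where c: "\<And>n \<tau>. U \<tau> = Some (initial_segment x n) \<Longrightarrow> n \<le> length \<tau> + c"
    using x unfolding martin_loef_random_iff by blast
  obtain k \<tau> where k: "U \<tau> = Some (initial_segment x n @ replicate k True)"
    "length \<tau> + c < length (initial_segment x n) + k"
    using ones_compressible[OF U] by blast
  have "initial_segment x n @ replicate k True = initial_segment x (n + k)"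
    by (rule nth_equalityI) (auto simp: initial_segment_def nth_append tr)
  with k c[of \<tau> "n + k"] show False by (simp add: initial_segment_def)
qed

section \<open>Limits of dyadic approximations\<close>

text \<open>Numerators of a nondecreasing sequence of dyadics with denominator \<open>2 ^ s\<close>
  at stage \<open>s\<close>. Strictness yields the bound \<open>1 - 1 / 2 ^ s\<close>, on which the
  later upward switch to a spare real rests.\<close>

definition grid_seq :: "(nat \<Rightarrow> nat) \<Rightarrow> bool" where
  "grid_seq A \<longleftrightarrow> (\<forall>s. 2 * A s \<le> A (Suc s) \<and> A s < 2 ^ s)"

definition grid_lim :: "(nat \<Rightarrow> nat) \<Rightarrow> real" where
  "grid_lim A = (SUP s. real (A s) / 2 ^ s)"

lemma doubling_iterate: "2 ^ d * A s \<le> A (s + d)" if "\<And>s. 2 * A s \<le> A (Suc s)" for A :: "nat \<Rightarrow> nat"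
proof (induction d)
  case (Suc d)
  then show ?case using that[of "s + d"] by simp
qed simp

lemma grid_seqI:
  assumes dbl: "\<And>s. 2 * A s \<le> A (Suc s)" and "\<And>s. m \<le> s \<Longrightarrow> A s < 2 ^ s"
  shows "grid_seq A"
proof -
  have "A s < 2 ^ s" for s
  proof -
    have "2 ^ m * A s \<le> A (s + m)" by (rule doubling_iterate) (rule dbl)
    also have "\<dots> < 2 ^ (s + m)" by (rule assms(2)) simp
    also have "\<dots> = 2 ^ m * 2 ^ s" by (simp add: power_add)
    finally show ?thesis by simp
  qed
  with dbl show ?thesis by (simp add: grid_seq_def)
qed

context
  fixes A assumes A: "grid_seq A"
begin

lemma grid_seq_mono: "s \<le> s' \<Longrightarrow> real (A s) / 2 ^ s \<le> real (A s') / 2 ^ s'"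
proof -
  assume "s \<le> s'"
  then obtain d where d: "s' = s + d" by (auto simp: le_iff_add)
  have "2 ^ d * A s \<le> A s'" using doubling_iterate[of A d s] A d by (simp add: grid_seq_def)
  then have "real (2 ^ d * A s) \<le> real (A s')" by (rule of_nat_mono)
  then show ?thesis by (simp add: d power_add field_simps)
qed

lemma grid_seq_le_1: "real (A s) / 2 ^ s \<le> 1 - 1 / 2 ^ s"
proof -
  have "Suc (A s) \<le> 2 ^ s" using A by (simp add: grid_seq_def Suc_le_eq)
  then have "real (A s) + 1 \<le> 2 ^ s" by (metis of_nat_Suc of_nat_le_iff of_nat_numeral of_nat_power add.commute)
  then show ?thesis by (simp add: field_simps)
qed

lemma bdd_above_grid_seq: "bdd_above (range (\<lambda>s. real (A s) / 2 ^ s))"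
proof (rule bdd_aboveI2)
  fix s
  have "0 \<le> 1 / (2 ^ s :: real)" by simp
  then show "real (A s) / 2 ^ s \<le> 1" using grid_seq_le_1[of s] by linarith
qed

lemma grid_seq_le_lim: "real (A s) / 2 ^ s \<le> grid_lim A"
  unfolding grid_lim_def by (rule cSUP_upper[OF UNIV_I bdd_above_grid_seq])

lemma less_grid_lim_iff: "q < grid_lim A \<longleftrightarrow> (\<exists>s. q < real (A s) / 2 ^ s)"
  unfolding grid_lim_def using less_cSUP_iff[OF _ bdd_above_grid_seq] by simp

lemma grid_lim_le: "(\<And>s. real (A s) / 2 ^ s \<le> b) \<Longrightarrow> grid_lim A \<le> b"
  unfolding grid_lim_def by (rule cSUP_least) auto

lemma grid_lim_nonneg: "0 \<le> grid_lim A"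
  using grid_seq_le_lim[of 0] by (rule order_trans[rotated]) simp

lemma grid_lim_le_1: "grid_lim A \<le> 1"
proof (rule grid_lim_le)
  fix s
  have "0 \<le> 1 / (2 ^ s :: real)" by simp
  then show "real (A s) / 2 ^ s \<le> 1" using grid_seq_le_1[of s] by linarith
qed

lemma eventually_less_grid_seq:
  "q < grid_lim A \<Longrightarrow> \<forall>\<^sub>F s in sequentially. q < real (A s) / 2 ^ s"
  unfolding less_grid_lim_iff eventually_sequentially
  using grid_seq_mono by (meson order.strict_trans2)

lemma grid_seq_tendsto: "(\<lambda>s. real (A s) / 2 ^ s) \<longlonglongrightarrow> grid_lim A"
  by (rule order_tendstoI)
    (auto intro: eventually_less_grid_seq eventuallyI le_less_trans[OF grid_seq_le_lim])

end

section \<open>Comparing two approximations at a finite stage\<close>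

definition grid_close :: "nat \<Rightarrow> nat \<Rightarrow> nat \<Rightarrow> nat \<Rightarrow> bool" where
  "grid_close t s a b \<longleftrightarrow> a * 2 ^ t < b * 2 ^ t + 2 ^ s \<and> b * 2 ^ t < a * 2 ^ t + 2 ^ s"

lemma grid_close_iff: "grid_close t s a b \<longleftrightarrow> \<bar>real a / 2 ^ s - real b / 2 ^ s\<bar> < 1 / 2 ^ t"
proof -
  have "x * 2 ^ t < y * 2 ^ t + 2 ^ s \<longleftrightarrow> real x / 2 ^ s - real y / 2 ^ s < 1 / 2 ^ t" for x y
  proof -
    have "x * 2 ^ t < y * 2 ^ t + 2 ^ s \<longleftrightarrow> real (x * 2 ^ t) < real (y * 2 ^ t + 2 ^ s)"
      by (rule of_nat_less_iff[symmetric])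
    also have "\<dots> \<longleftrightarrow> real x / 2 ^ s - real y / 2 ^ s < 1 / 2 ^ t"
      by (simp add: field_simps)
    finally show ?thesis .
  qed
  from this[of a b] this[of b a] show ?thesis unfolding grid_close_def by linarith
qed

lemma decidable_grid_close [computable_intros]:
  assumes "computable f" "computable g" "computable h" "computable k"
  shows "decidable (\<lambda>z. grid_close (f z) (g z) (h z) (k z))"
  unfolding grid_close_def by (intro computable_intros assms)

lemma eventually_grid_close:
  assumes A: "grid_seq A" and B: "grid_seq B" and eq: "grid_lim A = grid_lim B"
  shows "\<forall>\<^sub>F s in sequentially. grid_close t s (A s) (B s)"
proof -
  have "(\<lambda>s. real (A s) / 2 ^ s - real (B s) / 2 ^ s) \<longlonglongrightarrow> 0"
    using tendsto_diff[OF grid_seq_tendsto[OF A] grid_seq_tendsto[OF B]] eq by simp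
  from tendstoD[OF this, of "1 / 2 ^ t"] show ?thesis
    by (simp add: grid_close_iff dist_real_def)
qed

lemma eventually_power_half_less: "0 < e \<Longrightarrow> \<forall>\<^sub>F t in sequentially. 1 / 2 ^ t < (e :: real)"
  using order_tendstoD(2)[OF LIMSEQ_power_zero[of "1 / 2 :: real"]] by (simp add: power_one_over)

text \<open>From some point on the approximations stay farther apart than half the distance of their
  limits. One precision then fails at all stages from \<open>t\<close> on, which is the uniformity
  needed to refute \<open>near\<close>.\<close>

lemma eventually_not_grid_close:
  assumes A: "grid_seq A" and B: "grid_seq B" and "grid_lim A \<noteq> grid_lim B"
  shows "\<forall>\<^sub>F t in sequentially. \<forall>s\<ge>t. \<not> grid_close t s (A s) (B s)"
proof -
  let ?d = "\<bar>grid_lim A - grid_lim B\<bar>"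
  have "?d / 2 < ?d" using assms(3) by simp
  moreover have "(\<lambda>s. \<bar>real (A s) / 2 ^ s - real (B s) / 2 ^ s\<bar>) \<longlonglongrightarrow> ?d"
    by (intro tendsto_rabs tendsto_diff grid_seq_tendsto A B)
  ultimately have "\<forall>\<^sub>F s in sequentially. ?d / 2 < \<bar>real (A s) / 2 ^ s - real (B s) / 2 ^ s\<bar>"
    by (rule order_tendstoD(1)[rotated])
  then have "\<forall>\<^sub>F t in sequentially. \<forall>s\<ge>t. ?d / 2 < \<bar>real (A s) / 2 ^ s - real (B s) / 2 ^ s\<bar>"
    by (rule eventually_all_ge_at_top)
  moreover have "\<forall>\<^sub>F t in sequentially. 1 / 2 ^ t < ?d / 2"
    using assms(3) by (intro eventually_power_half_less) simp
  ultimately show ?thesis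
    by eventually_elim (fastforce simp: grid_close_iff)
qed

section \<open>Rounding up to a random real\<close>

locale universal_machine =
  fixes U :: "bitstring \<rightharpoonup> bitstring" and f :: "nat \<rightharpoonup> nat" and F :: "nat \<Rightarrow> nat \<Rightarrow> nat"
  assumes universal: "universal_prefix_free_machine U"
    and f_U: "f (string_code \<sigma>) = map_option string_code (U \<sigma>)"
    and F: "stage_approx F f"
begin

lemma U_iff_F: "U \<sigma> = Some \<tau> \<longleftrightarrow> (\<exists>s. F (string_code \<sigma>) s = Suc (string_code \<tau>))"
proof -
  have "U \<sigma> = Some \<tau> \<longleftrightarrow> f (string_code \<sigma>) = Some (string_code \<tau>)"
    unfolding f_U by (cases "U \<sigma>") auto
  then show ?thesis using stage_approx_Some_iff[OF F] by simp
qed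

lemma U_defined_iff_F: "U \<sigma> \<noteq> None \<longleftrightarrow> (\<exists>s. F (string_code \<sigma>) s \<noteq> 0)"
proof -
  have "U \<sigma> \<noteq> None \<longleftrightarrow> (\<exists>y. f (string_code \<sigma>) = Some y)" unfolding f_U by auto
  then show ?thesis using stage_approx_Some_iff[OF F] by (metis not0_implies_Suc nat.distinct(1))
qed

text \<open>The dyadic interval \<open>[k / 2^s, (k + 1) / 2^s)\<close> is bad if it lies inside a cylinder
  whose string is seen by stage \<open>s\<close> to be compressible by more than \<open>c\<close> bits.\<close>

definition bad :: "nat \<Rightarrow> nat \<Rightarrow> nat \<Rightarrow> bool" where
  "bad c s k \<longleftrightarrow> (\<exists>n\<le>s. \<exists>m\<le>s. m + c < n \<and>
     (\<exists>i<2 ^ m. F (bin_code m i 0) s = Suc (bin_code n (k div 2 ^ (s - n)) 0)))"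

lemma decidable_bad [computable_intros]:
  assumes c: "computable c" and s: "computable s" and k: "computable k"
  shows "decidable (\<lambda>z. bad (c z) (s z) (k z))"
  unfolding bad_def
  by (intro computable_intros stage_approx_computable[OF F] computable_compose[OF c]
      computable_compose[OF s] computable_compose[OF k] assms)

lemma bad_iff:
  "bad c s k \<longleftrightarrow> (\<exists>n\<le>s. \<exists>\<tau>. length \<tau> \<le> s \<and> length \<tau> + c < n \<and>
     F (string_code \<tau>) s = Suc (string_code (bin n (k div 2 ^ (s - n)))))"
proof -
  have "(\<exists>m\<le>s. m + c < n \<and> (\<exists>i<2 ^ m. F (bin_code m i 0) s = y)) \<longleftrightarrow>
    (\<exists>\<tau>. length \<tau> \<le> s \<and> length \<tau> + c < n \<and> F (string_code \<tau>) s = y)" (is "?l = ?r") for n y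
  proof
    assume ?l
    then show ?r by (metis bin_code_0 length_bin)
  next
    assume ?r
    then show ?l by (metis bin_code_0 ex_bin)
  qed
  then show ?thesis unfolding bad_def bin_code_0[of _ "k div _"] by simp
qed

text \<open>The cylinder and the description that spoil an interval spoil both its halves, since
  halted computations persist.\<close>

lemma bad_div2:
  assumes "bad c s (k div 2)" shows "bad c (Suc s) k"
proof -
  obtain n \<tau> where n: "n \<le> s" "length \<tau> \<le> s" "length \<tau> + c < n"
    "F (string_code \<tau>) s = Suc (string_code (bin n (k div 2 div 2 ^ (s - n))))"
    using assms unfolding bad_iff by blast
  have "k div 2 div 2 ^ (s - n) = k div 2 ^ (Suc s - n)"
    using n(1) by (simp add: div_mult2_eq Suc_diff_le)
  with n stage_approx_mono[OF F n(4), of "Suc s"] show ?thesis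
    unfolding bad_iff by (intro exI[of _ n] exI[of _ \<tau>] conjI) auto
qed

text \<open>A bad interval of level \<open>s\<close> extends the output of some program
  \<open>\<tau>\<close>, and this output is longer than \<open>length \<tau> + c\<close>. So at most
  \<open>2 ^ (s - length \<tau>) / 2 ^ Suc c\<close> intervals are charged to \<open>\<tau>\<close>,
  and Kraft's inequality sums these bounds.\<close>

lemma card_bad: "card {k. k < 2 ^ s \<and> bad c s k} * 2 ^ Suc c \<le> 2 ^ s"
proof -
  let ?T = "{\<tau>. length \<tau> \<le> s \<and> (\<exists>\<sigma>. U \<tau> = Some \<sigma> \<and> length \<sigma> \<le> s \<and> length \<tau> + c < length \<sigma>)}"
  let ?u = "\<lambda>\<tau>. the (U \<tau>)"
  let ?E = "\<lambda>\<tau>. {\<sigma>. length \<sigma> = s \<and> prefix (?u \<tau>) \<sigma>}"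
  have fin: "finite ?T"
    by (rule finite_subset[OF _ finite_lists_length_le[of "UNIV :: bool set" s]]) auto
  have "bin s ` {k. k < 2 ^ s \<and> bad c s k} \<subseteq> (\<Union>\<tau>\<in>?T. ?E \<tau>)"
  proof (clarify)
    fix k assume "bad c s k"
    then obtain n \<tau> where n: "n \<le> s" "length \<tau> \<le> s" "length \<tau> + c < n"
      "F (string_code \<tau>) s = Suc (string_code (bin n (k div 2 ^ (s - n))))"
      unfolding bad_iff by blast
    from n(1,4) have "U \<tau> = Some (take n (bin s k))" unfolding U_iff_F by (auto simp: take_bin)
    with n show "bin s k \<in> (\<Union>\<tau>\<in>?T. ?E \<tau>)"
      by (intro UN_I[of \<tau>]) (auto simp: take_is_prefix)
  qed
  moreover have "inj_on (bin s) {k. k < 2 ^ s \<and> bad c s k}"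
    by (rule inj_on_subset[OF inj_on_bin]) auto
  moreover have "finite (\<Union>\<tau>\<in>?T. ?E \<tau>)"
    by (rule finite_subset[OF _ finite_bitstrings[of s]]) auto
  ultimately have "card {k. k < 2 ^ s \<and> bad c s k} \<le> card (\<Union>\<tau>\<in>?T. ?E \<tau>)"
    by (intro card_inj_on_le)
  also have "\<dots> \<le> (\<Sum>\<tau>\<in>?T. card (?E \<tau>))" by (rule card_UN_le[OF fin])
  also have "\<dots> = (\<Sum>\<tau>\<in>?T. 2 ^ (s - length (?u \<tau>)))"
    by (intro sum.cong refl card_prefix_extensions) auto
  finally have "card {k. k < 2 ^ s \<and> bad c s k} * 2 ^ Suc c \<le>
      (\<Sum>\<tau>\<in>?T. 2 ^ (s - length (?u \<tau>))) * 2 ^ Suc c" by (rule mult_le_mono1)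
  also have "\<dots> = (\<Sum>\<tau>\<in>?T. 2 ^ (s - length (?u \<tau>) + Suc c))"
    by (simp only: sum_distrib_right power_add)
  also have "\<dots> \<le> (\<Sum>\<tau>\<in>?T. 2 ^ (s - length \<tau>))"
    by (intro sum_mono power_increasing) auto
  also have "\<dots> \<le> 2 ^ s"
    using universal fin
    by (intro Kraft_inequality) (auto simp: universal_prefix_free_machine_def prefix_free_machine_def)
  finally show ?thesis .
qed

text \<open>Indices from \<open>2 ^ s\<close> on lie outside the unit interval and count as good, so
  that the least number exists.\<close>

definition round_up :: "nat \<Rightarrow> nat \<Rightarrow> nat \<Rightarrow> nat" where
  "round_up c l s = (LEAST k. l \<le> k \<and> (k < 2 ^ s \<longrightarrow> \<not> bad c s k))"

lemma ex_round_up: "\<exists>k. l \<le> k \<and> (k < 2 ^ s \<longrightarrow> \<not> bad c s k)"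
  by (rule exI[of _ "max l (2 ^ s)"]) auto

lemma round_up:
  shows round_up_ge: "l \<le> round_up c l s"
    and round_up_not_bad: "round_up c l s < 2 ^ s \<Longrightarrow> \<not> bad c s (round_up c l s)"
  using LeastI_ex[OF ex_round_up] unfolding round_up_def by blast+

lemma round_up_le: "l \<le> k \<Longrightarrow> (k < 2 ^ s \<Longrightarrow> \<not> bad c s k) \<Longrightarrow> round_up c l s \<le> k"
  unfolding round_up_def by (rule Least_le) blast

lemma computable_round_up [computable_intros]:
  assumes c: "computable c" and l: "computable l" and s: "computable s"
  shows "computable (\<lambda>z. round_up (c z) (l z) (s z))"
  unfolding round_up_def
  by (intro computable_Least ex_round_up) (intro computable_intros computable_compose[OF c]
      computable_compose[OF s] computable_compose[OF l])

text \<open>The interval around a good one is good a stage earlier, as badness passes to halves.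
  Hence rounding keeps nondecreasing approximations nondecreasing.\<close>

lemma round_up_double:
  assumes "2 * l \<le> l'" shows "2 * round_up c l s \<le> round_up c l' (Suc s)"
proof -
  let ?k = "round_up c l' (Suc s)"
  have "round_up c l s \<le> ?k div 2"
  proof (rule round_up_le)
    show "l \<le> ?k div 2" using assms round_up_ge[of l' c "Suc s"] by linarith
    assume "?k div 2 < 2 ^ s"
    then have "\<not> bad c (Suc s) ?k" by (intro round_up_not_bad) auto
    then show "\<not> bad c s (?k div 2)" using bad_div2 by blast
  qed
  then show ?thesis by linarith
qed

text \<open>Every skipped index is bad, so the distance travelled is at most the measure bounded by
  \<open>card_bad\<close>.\<close>

lemma round_up_bound: "round_up c l s * 2 ^ Suc c \<le> l * 2 ^ Suc c + 2 ^ s"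
proof -
  have "{l..<round_up c l s} \<subseteq> {k. k < 2 ^ s \<and> bad c s k}"
  proof clarsimp
    fix k assume "l \<le> k" "k < round_up c l s"
    then show "k < 2 ^ s \<and> bad c s k" using round_up_le[of l k s c] by linarith
  qed
  from card_mono[OF _ this] have "round_up c l s - l \<le> card {k. k < 2 ^ s \<and> bad c s k}" by simp
  then have "(round_up c l s - l) * 2 ^ Suc c \<le> 2 ^ s"
    using card_bad[of s c] by (meson mult_le_mono1 order_trans)
  then show ?thesis by (simp add: diff_mult_distrib)
qed

section \<open>Limits of rounded approximations\<close>

context
  fixes c :: nat and L A :: "nat \<Rightarrow> nat"
  assumes A_def: "A = (\<lambda>s. round_up c (L s) s)" and A: "grid_seq A"
begin

text \<open>A short description of the cylinder would be seen at some stage, after which all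
  intervals inside the cylinder are bad; but rounded values never lie in bad intervals.\<close>

lemma round_up_avoids:
  assumes ev: "\<forall>\<^sub>F s in sequentially. real j / 2 ^ n \<le> real (A s) / 2 ^ s \<and> real (A s) / 2 ^ s < (real j + 1) / 2 ^ n"
    and U: "U \<tau> = Some (bin n j)"
  shows "n \<le> length \<tau> + c"
proof (rule ccontr)
  assume short: "\<not> n \<le> length \<tau> + c"
  obtain y where "F (string_code \<tau>) y = Suc (string_code (bin n j))" using U U_iff_F by blast
  then have "\<forall>\<^sub>F s in sequentially. F (string_code \<tau>) s = Suc (string_code (bin n j))"
    using stage_approx_mono[OF F] unfolding eventually_sequentially by blast
  then have "\<forall>\<^sub>F s in sequentially. False"
    using ev eventually_ge_at_top[of n] eventually_ge_at_top[of "length \<tau>"]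
  proof eventually_elim
    case (elim s)
    have p: "(2 :: real) ^ s = 2 ^ n * 2 ^ (s - n)" using elim(3) by (simp flip: power_add)
    define q where "q = real (A s) / 2 ^ (s - n)"
    from elim(2) have "real j / 2 ^ n \<le> q / 2 ^ n" "q / 2 ^ n < (real j + 1) / 2 ^ n"
      by (simp_all add: p q_def mult.commute)
    then have "real j \<le> q" "q < real j + 1"
      by (simp_all add: divide_le_cancel divide_less_cancel)
    then have "real j * 2 ^ (s - n) \<le> real (A s)" "real (A s) < (real j + 1) * 2 ^ (s - n)"
      by (simp_all add: q_def pos_le_divide_eq pos_divide_less_eq)
    then have "real (j * 2 ^ (s - n)) \<le> real (A s)" "real (A s) < real (Suc j * 2 ^ (s - n))"
      by (simp_all add: algebra_simps)
    then have "j * 2 ^ (s - n) \<le> A s" "A s < Suc j * 2 ^ (s - n)" by (simp_all only: of_nat_le_iff of_nat_less_iff)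
    then have "A s div 2 ^ (s - n) = j" by (intro div_nat_eqI) (simp_all add: mult.commute)
    with elim short have "bad c s (A s)"
      unfolding bad_iff by (intro exI[of _ n] exI[of _ \<tau>] conjI) auto
    then show False using round_up_not_bad[of c "L s" s] A by (simp add: A_def grid_seq_def)
  qed
  then show False by simp
qed

text \<open>If the limit is the left end of a cylinder, all approximations might lie outside it,
  where \<open>round_up_avoids\<close> says nothing. That is impossible: they would settle in every
  cylinder ending at the dyadic, and with enough trailing ones its string is compressible.\<close>

lemma round_up_lim_not_approached_dyadic:
  assumes "grid_lim A = real j / 2 ^ n"
  shows "\<exists>s. real (A s) / 2 ^ s = grid_lim A"
proof (rule ccontr)
  assume "\<nexists>s. real (A s) / 2 ^ s = grid_lim A"
  then have less: "real (A s) / 2 ^ s < grid_lim A" for s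
    using grid_seq_le_lim[OF A, of s] by (simp add: less_le)
  have "0 < grid_lim A" using less[of 0] by (rule le_less_trans[rotated]) simp
  with assms have "j \<noteq> 0" by (intro notI) simp
  then obtain i where i: "j = Suc i" by (cases j) auto
  obtain k \<tau> where k: "U \<tau> = Some (bin n i @ replicate k True)" "length \<tau> + c < n + k"
    using ones_compressible[OF universal, of "bin n i" c] by auto
  \<comment> \<open>Number of the last interval of length 2^-(n+k) before the dyadic
    \<open>j / 2 ^ n\<close>.\<close>
  define h where "h = i * 2 ^ k + (2 ^ k - 1)"
  have h: "Suc h = j * 2 ^ k" by (simp add: h_def i)
  then have "real h + 1 = real j * 2 ^ k" by (metis of_nat_Suc of_nat_mult of_nat_numeral of_nat_power add.commute)
  then have lim: "grid_lim A = (real h + 1) / 2 ^ (n + k)" by (simp add: assms power_add)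
  have "real h / 2 ^ (n + k) < grid_lim A" by (simp add: lim divide_strict_right_mono)
  from eventually_less_grid_seq[OF A this]
  have "\<forall>\<^sub>F s in sequentially. real h / 2 ^ (n + k) \<le> real (A s) / 2 ^ s \<and> real (A s) / 2 ^ s < (real h + 1) / 2 ^ (n + k)"
    by eventually_elim (use less lim in auto)
  moreover have "U \<tau> = Some (bin (n + k) h)" using k(1) by (simp only: h_def bin_ones)
  ultimately show False using round_up_avoids k(2) by fastforce
qed

text \<open>The value 1 is dyadic, so it would be attained at some stage, but
  \<open>A s < 2 ^ s\<close>.\<close>

lemma round_up_lim_less_1: "grid_lim A < 1"
proof -
  have "grid_lim A \<noteq> 1"
  proof
    assume 1: "grid_lim A = 1"
    then obtain s where "real (A s) / 2 ^ s = 1"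
      using round_up_lim_not_approached_dyadic[of 1 0] by auto
    moreover have "0 < 1 / (2 ^ s :: real)" by simp
    ultimately show False using grid_seq_le_1[OF A, of s] by linarith
  qed
  then show ?thesis using grid_lim_le_1[OF A] by simp
qed

lemma round_up_lim_random: "martin_loef_random U (bits (grid_lim A))"
  unfolding martin_loef_random_iff
proof (intro exI allI impI)
  fix n \<tau>
  let ?a = "grid_lim A"
  define j where "j = nat \<lfloor>?a * 2 ^ n\<rfloor>"
  assume "U \<tau> = Some (initial_segment (bits ?a) n)"
  then have U: "U \<tau> = Some (bin n j)"
    by (simp add: initial_segment_bits grid_lim_nonneg[OF A] j_def)
  have "real j \<le> ?a * 2 ^ n" "?a * 2 ^ n < real j + 1"
    using grid_lim_nonneg[OF A] by (simp_all add: j_def of_nat_nat)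
  then have j: "real j / 2 ^ n \<le> ?a" "?a < (real j + 1) / 2 ^ n" by (simp_all add: field_simps)
  \<comment> \<open>Only the left endpoint needs care: the approximations must enter the half-open
    cylinder of their limit.\<close>
  have "\<exists>s. real j / 2 ^ n \<le> real (A s) / 2 ^ s"
  proof (cases "?a = real j / 2 ^ n")
    case True
    then show ?thesis using round_up_lim_not_approached_dyadic[OF True] by (metis order_refl)
  next
    case False
    with j(1) have "real j / 2 ^ n < ?a" by simp
    then show ?thesis unfolding less_grid_lim_iff[OF A] by (auto intro: less_imp_le)
  qed
  then have "\<forall>\<^sub>F s in sequentially. real j / 2 ^ n \<le> real (A s) / 2 ^ s \<and> real (A s) / 2 ^ s < (real j + 1) / 2 ^ n"
    using grid_seq_mono[OF A] grid_seq_le_lim[OF A] j(2)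
    unfolding eventually_sequentially by (meson le_less_trans order_trans)
  from round_up_avoids[OF this U] show "n \<le> length \<tau> + c" .
qed

end

text \<open>With randomness constant \<open>c\<close>, no interval containing \<open>x\<close> is
  ever bad, so rounding from below stops at the interval of \<open>x\<close> at the latest. This is
  why rounding loses no random real.\<close>

lemma round_up_le_random:
  assumes "0 \<le> x" "x < 1" "real l \<le> x * 2 ^ s"
    and x: "\<And>n \<tau>. U \<tau> = Some (initial_segment (bits x) n) \<Longrightarrow> n \<le> length \<tau> + c"
  shows "real (round_up c l s) \<le> x * 2 ^ s"
proof -
  let ?k = "nat \<lfloor>x * 2 ^ s\<rfloor>"
  have "round_up c l s \<le> ?k"
  proof (rule round_up_le)
    show "l \<le> ?k" using assms(3) by (simp add: le_nat_iff le_floor_iff)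
    show "\<not> bad c s ?k"
    proof
      assume "bad c s ?k"
      then obtain n \<tau> where n: "n \<le> s" "length \<tau> + c < n"
        "F (string_code \<tau>) s = Suc (string_code (bin n (?k div 2 ^ (s - n))))"
        unfolding bad_iff by blast
      then have "U \<tau> = Some (initial_segment (bits x) n)"
        unfolding U_iff_F using assms(1) by (auto simp: initial_segment_bits nat_floor_div_power2)
      from x[OF this] n(2) show False by simp
    qed
  qed
  then have "real (round_up c l s) \<le> real ?k" by simp
  also have "\<dots> \<le> x * 2 ^ s" using assms(1) by (simp add: of_nat_nat)
  finally show ?thesis .
qed

end

context universal_machine
begin

section \<open>A numbering with repetitions\<close>

text \<open>The index \<open>((l, i), m)\<close> stands for the c.e. set of fractions below \<open>1 - 2^-m\<close> that is
  given by the prefix \<open>bin l i\<close> of \<open>U\<close>, rounded up to avoid all strings compressible by more than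
  \<open>m\<close> bits.  By Kraft's inequality these have measure at most \<open>2^-(m+1)\<close>, so the result is below 1.\<close>

definition enumerated :: "nat \<Rightarrow> nat \<Rightarrow> nat \<Rightarrow> nat \<Rightarrow> bool" where
  "enumerated p s a b \<longleftrightarrow>
     F (bin_code (pfst (pfst p)) (psnd (pfst p)) (unary_code (prod_encode (a, b)))) s \<noteq> 0 \<and>
     a * 2 ^ psnd p \<le> (2 ^ psnd p - 1) * 2 ^ b"

text \<open>The maximum of the enumerated fractions in units of 2^-s, written as a least upper bound
  so that a search computes it. The restriction \<open>b \<le> s\<close> makes the scaling
  exact.\<close>

definition lower_bound :: "nat \<Rightarrow> nat \<Rightarrow> nat" where
  "lower_bound p s = (LEAST k. \<forall>a\<le>s. \<forall>b\<le>s. enumerated p s a b \<longrightarrow> a * 2 ^ (s - b) \<le> k)"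

definition random_approx :: "nat \<Rightarrow> nat \<Rightarrow> nat" where
  "random_approx p s = round_up (psnd p) (lower_bound p s) s"

lemma decidable_enumerated [computable_intros]:
  assumes "computable p" "computable s" "computable a" "computable b"
  shows "decidable (\<lambda>z. enumerated (p z) (s z) (a z) (b z))"
  unfolding enumerated_def by (intro computable_intros stage_approx_computable[OF F] assms)

lemma ex_lower_bound: "\<exists>k. \<forall>a\<le>s. \<forall>b\<le>s. enumerated p s a b \<longrightarrow> a * 2 ^ (s - b) \<le> k"
proof -
  have "a * 2 ^ (s - b) \<le> s * 2 ^ s" if "a \<le> s" for a b
    using that by (intro mult_le_mono power_increasing) auto
  then show ?thesis by blast
qed

lemma lower_bound_ge: "a \<le> s \<Longrightarrow> b \<le> s \<Longrightarrow> enumerated p s a b \<Longrightarrow> a * 2 ^ (s - b) \<le> lower_bound p s"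
  using LeastI_ex[OF ex_lower_bound[of s p]] unfolding lower_bound_def by blast

lemma lower_bound_le:
  "(\<And>a b. a \<le> s \<Longrightarrow> b \<le> s \<Longrightarrow> enumerated p s a b \<Longrightarrow> a * 2 ^ (s - b) \<le> k) \<Longrightarrow> lower_bound p s \<le> k"
  unfolding lower_bound_def by (rule Least_le) blast

lemma computable_random_approx [computable_intros]:
  assumes p: "computable p" and s: "computable s"
  shows "computable (\<lambda>z. random_approx (p z) (s z))"
  unfolding random_approx_def lower_bound_def
  by (intro computable_round_up computable_psnd assms computable_Least ex_lower_bound)
    (intro computable_intros computable_compose[OF p] computable_compose[OF s])

lemma enumerated_mono: "enumerated p s a b \<Longrightarrow> s \<le> s' \<Longrightarrow> enumerated p s' a b"
  unfolding enumerated_def using stage_approx_mono[OF F] by (metis not0_implies_Suc nat.distinct(1))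

lemma lower_bound_double: "2 * lower_bound p s \<le> lower_bound p (Suc s)"
proof -
  have "lower_bound p s \<le> lower_bound p (Suc s) div 2"
  proof (rule lower_bound_le)
    fix a b assume ab: "a \<le> s" "b \<le> s" "enumerated p s a b"
    then have "a * 2 ^ (Suc s - b) \<le> lower_bound p (Suc s)"
      by (intro lower_bound_ge enumerated_mono[OF ab(3)]) auto
    then show "a * 2 ^ (s - b) \<le> lower_bound p (Suc s) div 2" using ab by (simp add: Suc_diff_le)
  qed
  then show ?thesis by linarith
qed

lemma lower_bound_cap:
  assumes "psnd p \<le> s" shows "lower_bound p s \<le> (2 ^ psnd p - 1) * 2 ^ (s - psnd p)"
proof (rule lower_bound_le)
  let ?m = "psnd p"
  fix a b assume ab: "b \<le> s" "enumerated p s a b"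
  have p1: "(2 :: nat) ^ (s - b) * 2 ^ b = 2 ^ s" and p2: "(2 :: nat) ^ (s - ?m) * 2 ^ ?m = 2 ^ s"
    using ab(1) assms by (simp_all flip: power_add)
  have "a * 2 ^ ?m * 2 ^ (s - b) \<le> (2 ^ ?m - 1) * 2 ^ b * 2 ^ (s - b)"
    using ab(2) unfolding enumerated_def by (intro mult_le_mono1) simp
  also have "\<dots> = (2 ^ ?m - 1) * (2 ^ (s - ?m) * 2 ^ ?m)" by (simp only: p1 p2 mult.assoc mult.commute[of "2 ^ b"])
  finally have "a * 2 ^ (s - b) * 2 ^ ?m \<le> (2 ^ ?m - 1) * 2 ^ (s - ?m) * 2 ^ ?m"
    by (simp only: mult.assoc mult.commute[of "2 ^ ?m" "2 ^ (s - b)"])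
  then show "a * 2 ^ (s - b) \<le> (2 ^ ?m - 1) * 2 ^ (s - ?m)" by simp
qed

lemma grid_seq_random_approx: "grid_seq (random_approx p)"
proof (rule grid_seqI)
  show "2 * random_approx p s \<le> random_approx p (Suc s)" for s
    unfolding random_approx_def by (rule round_up_double[OF lower_bound_double])
  fix s assume s: "psnd p \<le> s"
  let ?m = "psnd p"
  have p: "(2 :: nat) ^ (s - ?m) * 2 ^ ?m = 2 ^ s" using s by (simp flip: power_add)
  have "random_approx p s * 2 ^ Suc ?m \<le> lower_bound p s * 2 ^ Suc ?m + 2 ^ s"
    unfolding random_approx_def by (rule round_up_bound)
  also have "\<dots> \<le> (2 ^ ?m - 1) * 2 ^ (s - ?m) * 2 ^ Suc ?m + 2 ^ s"
    using lower_bound_cap[OF s] by (intro add_le_mono1 mult_le_mono1)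
  also have "(2 ^ ?m - 1) * 2 ^ (s - ?m) * 2 ^ Suc ?m = (2 ^ ?m - 1) * 2 * (2 ^ (s - ?m) * 2 ^ ?m :: nat)"
    by simp
  \<comment> \<open>This is \<open>(1 - 2^-m) + 2^-(m+1) = 1 - 2^-(m+1)\<close>, scaled to
    integers.\<close>
  also have "\<dots> + 2 ^ s = (2 ^ Suc ?m - 1) * 2 ^ s"
  proof -
    obtain q where "2 ^ ?m = Suc q" using not0_implies_Suc[of "2 ^ ?m"] by auto
    then show ?thesis unfolding p by (simp add: algebra_simps)
  qed
  also have "\<dots> < 2 ^ Suc ?m * 2 ^ s" by (rule mult_strict_right_mono) simp_all
  also have "\<dots> = 2 ^ s * 2 ^ Suc ?m" by (rule mult.commute)
  finally show "random_approx p s < 2 ^ s" by simp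
qed

definition random_real :: "nat \<Rightarrow> real" where
  "random_real p = grid_lim (random_approx p)"

lemma random_real:
  "0 \<le> random_real p" "random_real p < 1" "martin_loef_random U (bits (random_real p))"
proof -
  have eq: "random_approx p = (\<lambda>s. round_up (psnd p) (lower_bound p s) s)"
    by (simp add: fun_eq_iff random_approx_def)
  show "0 \<le> random_real p" "random_real p < 1" "martin_loef_random U (bits (random_real p))"
    unfolding random_real_def
    by (rule grid_lim_nonneg round_up_lim_less_1[OF eq] round_up_lim_random[OF eq] grid_seq_random_approx)+
qed

lemma ex_random_real:
  assumes ce: "left_ce x" and x: "martin_loef_random U x"
  shows "\<exists>p. random_real p = real_of_bitseq x"
proof -
  let ?x = "real_of_bitseq x"
  note bits = bitseq_eq_bits[OF random_not_eventually_true[OF universal x]]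
  obtain c where c: "\<And>n \<tau>. U \<tau> = Some (initial_segment x n) \<Longrightarrow> n \<le> length \<tau> + c"
    using x unfolding martin_loef_random_iff by blast
  have "\<forall>\<^sub>F m in sequentially. 1 / 2 ^ m < 1 - ?x"
    using bits(2) by (intro eventually_power_half_less) simp
  then have "\<forall>\<^sub>F m in sequentially. c \<le> m \<and> 1 / 2 ^ m < 1 - ?x"
    using eventually_ge_at_top[of c] by eventually_elim simp
  \<comment> \<open>One \<open>m\<close> has two tasks: as allowance it must be at least
    \<open>c\<close>, and the cap \<open>1 - 2^-m\<close> must lie above \<open>?x\<close>.\<close>
  then obtain m where m: "c \<le> m" "1 / 2 ^ m < 1 - ?x"
    using eventually_happens by force
  have c_m: "n \<le> length \<tau> + m" if "U \<tau> = Some (initial_segment x n)" for n \<tau>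
    using c[OF that] m(1) by simp
  obtain l i where li: "\<And>n. dyadic_of_code n \<in> dyadics \<and> dyadic_of_code n < ?x \<longleftrightarrow>
      U (bin l i @ unary n) \<noteq> None"
    using ce_set_universal[OF universal ce[unfolded left_ce_def ce_dyadic_set_def]] by auto
  define p where "p = prod_encode (prod_encode (l, i), m)"
  have dy: "dyadic_of_code (prod_encode (a, b)) = real a / 2 ^ b" for a b
    by (simp add: dyadic_of_code_def)
  have below: "real a / 2 ^ b < ?x" if "enumerated p s a b" for s a b
  proof -
    have "U (bin l i @ unary (prod_encode (a, b))) \<noteq> None"
      using that unfolding U_defined_iff_F enumerated_def p_def
      by (auto simp: unary_code_eq bin_code_string_code)
    with li show ?thesis by (metis dy)
  qed
  have above: "\<exists>s. enumerated p s a b" if ab: "real a / 2 ^ b < ?x" for a b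
  proof -
    have "real a / 2 ^ b \<le> 1" using ab bits(2) by linarith
    then have "real a / 2 ^ b \<in> dyadics" unfolding dyadics_def by blast
    with ab li[of "prod_encode (a, b)"] have "U (bin l i @ unary (prod_encode (a, b))) \<noteq> None"
      by (simp add: dy)
    then obtain s where s: "F (string_code (bin l i @ unary (prod_encode (a, b)))) s \<noteq> 0"
      unfolding U_defined_iff_F by blast
    have "real a / 2 ^ b \<le> 1 - 1 / 2 ^ m" using ab m(2) by linarith
    then have "real a * 2 ^ m \<le> (2 ^ m - 1) * 2 ^ b" by (simp add: field_simps)
    also have "\<dots> = real ((2 ^ m - 1) * 2 ^ b)" by (simp add: of_nat_diff)
    finally have "real (a * 2 ^ m) \<le> real ((2 ^ m - 1) * 2 ^ b)" by simp
    then have "a * 2 ^ m \<le> (2 ^ m - 1) * 2 ^ b" by (simp only: of_nat_le_iff)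
    with s have "enumerated p s a b"
      by (simp add: enumerated_def p_def unary_code_eq bin_code_string_code)
    then show ?thesis ..
  qed
  have "random_real p \<le> ?x"
    unfolding random_real_def
  proof (rule grid_lim_le[OF grid_seq_random_approx])
    fix s
    have "lower_bound p s \<le> nat \<lfloor>?x * 2 ^ s\<rfloor>"
    proof (rule lower_bound_le)
      fix a b assume ab: "b \<le> s" "enumerated p s a b"
      have "(2 :: real) ^ s = 2 ^ (s - b) * 2 ^ b" using ab(1) by (simp flip: power_add)
      with below[OF ab(2)] have "real (a * 2 ^ (s - b)) \<le> ?x * 2 ^ s" by (simp add: field_simps)
      then show "a * 2 ^ (s - b) \<le> nat \<lfloor>?x * 2 ^ s\<rfloor>"
        using bits(1) by (metis le_nat_floor)
    qed
    then have "real (lower_bound p s) \<le> real (nat \<lfloor>?x * 2 ^ s\<rfloor>)" by simp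
    also have "\<dots> \<le> ?x * 2 ^ s" using bits(1) by (simp add: of_nat_nat)
    finally have "real (random_approx p s) \<le> ?x * 2 ^ s"
      unfolding random_approx_def
      by (intro round_up_le_random bits(1,2)) (auto simp: bits(3) p_def intro: c_m)
    then show "real (random_approx p s) / 2 ^ s \<le> ?x" by (simp add: divide_le_eq)
  qed
  moreover have "\<not> random_real p < ?x"
  proof
    assume "random_real p < ?x"
    then obtain b where b: "1 / 2 ^ b < ?x - random_real p"
      using eventually_happens[OF eventually_power_half_less[of "?x - random_real p"]] by auto
    \<comment> \<open>The ceiling minus one keeps the fraction strictly below \<open>?x\<close> even
      if \<open>?x * 2 ^ b\<close> is an integer.\<close>
    define a where "a = nat \<lceil>?x * 2 ^ b\<rceil> - 1"
    have "0 < ?x * 2 ^ b" using random_real(1)[of p] \<open>random_real p < ?x\<close> by simp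
    then have "real a < ?x * 2 ^ b" "?x * 2 ^ b \<le> real a + 1"
      unfolding a_def by linarith+
    then have a: "real a / 2 ^ b < ?x" "?x \<le> real a / 2 ^ b + 1 / 2 ^ b" by (simp_all add: field_simps)
    obtain s0 where "enumerated p s0 a b" using above[OF a(1)] by blast
    \<comment> \<open>Stage \<open>s\<close> must also reach \<open>a\<close> and \<open>b\<close>,
      because \<open>lower_bound p s\<close> inspects only numerators and exponents up to
      \<open>s\<close>.\<close>
    define s where "s = max s0 (max a b)"
    have "(2 :: real) ^ s = 2 ^ (s - b) * 2 ^ b" by (simp add: s_def flip: power_add)
    moreover have "a * 2 ^ (s - b) \<le> random_approx p s"
      unfolding random_approx_def
      by (intro order_trans[OF lower_bound_ge round_up_ge] enumerated_mono[OF \<open>enumerated p s0 a b\<close>])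
        (auto simp: s_def)
    then have "real (a * 2 ^ (s - b)) \<le> real (random_approx p s)" by (rule of_nat_mono)
    ultimately have "real a / 2 ^ b \<le> real (random_approx p s) / 2 ^ s" by (simp add: field_simps)
    also have "\<dots> \<le> random_real p"
      unfolding random_real_def by (rule grid_seq_le_lim[OF grid_seq_random_approx])
    finally show False using a(2) b by linarith
  qed
  ultimately show ?thesis by (intro exI[of _ p]) simp
qed

section \<open>Spare random reals converging to 1\<close>

text \<open>With allowance \<open>Suc n\<close> the bad intervals have measure at most 2^-(n+2), a
  quarter of the distance from 1 - 2^-n to 1, so rounding stays clear of the next spare interval,
  which starts at 1 - 2^-(n+1). For \<open>s < n\<close> the truncated exponent makes the start
  \<open>2 ^ s - 1\<close>.\<close>

definition spare_approx :: "nat \<Rightarrow> nat \<Rightarrow> nat" where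
  "spare_approx n s = round_up (Suc n) (2 ^ s - 2 ^ (s - n)) s"

lemma computable_spare_approx [computable_intros]:
  assumes "computable n" "computable s"
  shows "computable (\<lambda>z. spare_approx (n z) (s z))"
  unfolding spare_approx_def by (intro computable_intros assms)

lemma spare_approx_upper:
  assumes "n \<le> s" shows "real (spare_approx n s) / 2 ^ s \<le> 1 - 3 / 4 * (1 / 2 ^ n)"
proof -
  have p: "(2 :: real) ^ s = 2 ^ (s - n) * 2 ^ n" using assms by (simp flip: power_add)
  have "spare_approx n s * 2 ^ Suc (Suc n) \<le> (2 ^ s - 2 ^ (s - n)) * 2 ^ Suc (Suc n) + 2 ^ s"
    unfolding spare_approx_def by (rule round_up_bound)
  then have "real (spare_approx n s * 2 ^ Suc (Suc n)) \<le> real ((2 ^ s - 2 ^ (s - n)) * 2 ^ Suc (Suc n) + 2 ^ s)"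
    by (rule of_nat_mono)
  also have "\<dots> = (2 ^ s - 2 ^ (s - n)) * 2 ^ Suc (Suc n) + 2 ^ s"
    by (simp add: of_nat_diff power_increasing)
  finally have "2 ^ n * (4 * real (spare_approx n s)) \<le> 2 ^ n * (4 * (2 ^ s - 2 ^ (s - n)) + 2 ^ (s - n))"
    by (simp add: p algebra_simps)
  then have "4 * real (spare_approx n s) \<le> 4 * (2 ^ s - 2 ^ (s - n)) + 2 ^ (s - n)"
    by (rule mult_left_le_imp_le) simp
  then show ?thesis by (simp add: p field_simps)
qed

lemma grid_seq_spare_approx: "grid_seq (spare_approx n)"
proof (rule grid_seqI)
  show "2 * spare_approx n s \<le> spare_approx n (Suc s)" for s
    unfolding spare_approx_def
  proof (rule round_up_double)
    have "1 \<le> (2 :: nat) ^ s" by simp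
    then show "2 * (2 ^ s - 2 ^ (s - n)) \<le> 2 ^ Suc s - (2 :: nat) ^ (Suc s - n)"
      by (cases "n \<le> s") (auto simp: Suc_diff_le diff_mult_distrib2)
  qed
  fix s assume "n \<le> s"
  have "0 < 3 / 4 * (1 / 2 ^ n :: real)" by simp
  then have "real (spare_approx n s) / 2 ^ s < 1" using spare_approx_upper[OF \<open>n \<le> s\<close>] by linarith
  then show "spare_approx n s < 2 ^ s" by simp
qed

definition spare_real :: "nat \<Rightarrow> real" where
  "spare_real n = grid_lim (spare_approx n)"

lemma spare_real:
  "0 \<le> spare_real n" "spare_real n < 1" "martin_loef_random U (bits (spare_real n))"
proof -
  have eq: "spare_approx n = (\<lambda>s. round_up (Suc n) (2 ^ s - 2 ^ (s - n)) s)"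
    by (simp add: fun_eq_iff spare_approx_def)
  show "0 \<le> spare_real n" "spare_real n < 1" "martin_loef_random U (bits (spare_real n))"
    unfolding spare_real_def
    by (rule grid_lim_nonneg round_up_lim_less_1[OF eq] round_up_lim_random[OF eq] grid_seq_spare_approx)+
qed

lemma spare_approx_lower:
  assumes "n \<le> s" shows "1 - 1 / 2 ^ n \<le> real (spare_approx n s) / 2 ^ s"
proof -
  have p: "(2 :: real) ^ s = 2 ^ (s - n) * 2 ^ n" using assms by (simp flip: power_add)
  have "real (2 ^ s - 2 ^ (s - n)) \<le> real (spare_approx n s)"
    unfolding spare_approx_def by (intro of_nat_mono round_up_ge)
  then have "real (2 ^ s - 2 ^ (s - n)) / 2 ^ s \<le> real (spare_approx n s) / 2 ^ s"
    by (rule divide_right_mono) simp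
  moreover have "real (2 ^ s - 2 ^ (s - n)) = 2 ^ s - 2 ^ (s - n)"
    by (simp add: of_nat_diff power_increasing)
  then have "real (2 ^ s - 2 ^ (s - n)) / 2 ^ s = 1 - 1 / 2 ^ n" by (simp add: p field_simps)
  ultimately show ?thesis by simp
qed

lemma spare_real_lower: "1 - 1 / 2 ^ n \<le> spare_real n"
  unfolding spare_real_def
  by (rule order_trans[OF spare_approx_lower[OF order_refl] grid_seq_le_lim[OF grid_seq_spare_approx]])

lemma spare_real_upper: "spare_real n < 1 - 1 / 2 ^ Suc n"
proof -
  have "real (spare_approx n s) / 2 ^ s \<le> 1 - 3 / 4 * (1 / 2 ^ n)" for s
    using grid_seq_mono[OF grid_seq_spare_approx, of s "max n s" n] spare_approx_upper[of n "max n s"]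
    by simp
  then have "spare_real n \<le> 1 - 3 / 4 * (1 / 2 ^ n)"
    unfolding spare_real_def by (rule grid_lim_le[OF grid_seq_spare_approx])
  also have "\<dots> < 1 - 1 / 2 ^ Suc n" by (simp add: field_simps)
  finally show ?thesis .
qed

lemma inj_spare_real: "inj spare_real"
proof (intro strict_mono_imp_inj_on strict_mono_Suc_iff[THEN iffD2] allI)
  fix n show "spare_real n < spare_real (Suc n)"
    using spare_real_upper[of n] spare_real_lower[of "Suc n"] by linarith
qed

end

section \<open>Removing repetitions\<close>

text \<open>\<open>near e t s\<close> is the evidence at stage \<open>s\<close> that \<open>a e\<close> agrees up to precision \<open>t\<close> with a value
  listed with higher priority.  The follower \<open>(e, t)\<close> copies \<open>a e\<close>; as soon as such evidence turns
  up it changes to the value of \<open>b\<close> whose number records this event, and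
  the next follower \<open>(e, Suc t)\<close> takes over the index freed by this.  So indices are never left
  unused and no value of \<open>b\<close> is listed twice.\<close>

locale friedberg_construction =
  fixes a b :: "nat \<Rightarrow> 'a" and near :: "nat \<Rightarrow> nat \<Rightarrow> nat \<Rightarrow> bool"
  assumes inj_b: "inj b"
    and near_antimono: "near e (Suc t) s \<Longrightarrow> near e t s"
    and near_iff: "(\<forall>t. \<exists>s. near e t s) \<longleftrightarrow> a e \<in> a ` {..<e} \<union> range b"
begin

text \<open>With the stage \<open>v\<close> as argument this is a bounded check, decidable if
  \<open>near\<close> is, whereas the existence of a release is only semidecidable.\<close>

definition release :: "nat \<Rightarrow> nat \<Rightarrow> nat \<Rightarrow> bool" where
  "release e t v \<longleftrightarrow> near e t v \<and> (\<forall>u<v. \<not> near e t u)"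

definition follower :: "nat \<Rightarrow> nat \<Rightarrow> 'a" where
  "follower e t = (if \<exists>s. near e t s then b (prod_encode (prod_encode (e, t), LEAST s. near e t s)) else a e)"

text \<open>Even indices hold the initial followers. The odd index \<open>2 * n + 1\<close> is the
  place of \<open>b n\<close>, unless \<open>n\<close> records the release of a follower
  \<open>(e, t)\<close>: then that follower already lists \<open>b n\<close>, and the place goes to
  \<open>(e, Suc t)\<close>.\<close>

definition numbering :: "nat \<Rightarrow> 'a" where
  "numbering k = (let n = k div 2 in
     if even k then follower n 0
     else if release (pfst (pfst n)) (psnd (pfst n)) (psnd n)
       then follower (pfst (pfst n)) (Suc (psnd (pfst n)))
     else b n)"

definition follower_index :: "nat \<Rightarrow> nat \<Rightarrow> nat" where
  "follower_index e t = (case t of 0 \<Rightarrow> 2 * e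
     | Suc t' \<Rightarrow> Suc (2 * prod_encode (prod_encode (e, t'), LEAST s. near e t' s)))"

definition active :: "nat \<Rightarrow> nat \<Rightarrow> bool" where
  "active e t \<longleftrightarrow> (case t of 0 \<Rightarrow> True | Suc t' \<Rightarrow> \<exists>s. near e t' s)"

lemma release_iff: "release e t v \<longleftrightarrow> (\<exists>s. near e t s) \<and> v = (LEAST s. near e t s)"
  unfolding release_def by (metis LeastI linorder_neqE_nat not_less_Least)

lemma near_le: "near e t s \<Longrightarrow> t' \<le> t \<Longrightarrow> near e t' s"
proof (induction t)
  case (Suc t)
  then show ?case using near_antimono by (metis le_Suc_eq)
qed simp

lemma numbering_follower_index: "active e t \<Longrightarrow> numbering (follower_index e t) = follower e t"
  by (cases t) (auto simp: numbering_def follower_index_def active_def release_iff Let_def)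

lemma numbering_spare:
  "\<not> release (pfst (pfst n)) (psnd (pfst n)) (psnd n) \<Longrightarrow> numbering (Suc (2 * n)) = b n"
  by (simp add: numbering_def)

lemma index_cases:
  obtains (follower) e t where "active e t" "k = follower_index e t"
  | (spare) n where "\<not> release (pfst (pfst n)) (psnd (pfst n)) (psnd n)" "k = Suc (2 * n)"
proof (cases "even k")
  case True
  then show ?thesis using follower[of "k div 2" 0] by (simp add: active_def follower_index_def)
next
  case False
  then obtain n where k: "k = Suc (2 * n)" by (auto elim: oddE)
  show ?thesis
  proof (cases "release (pfst (pfst n)) (psnd (pfst n)) (psnd n)")
    case True
    then have "\<exists>s. near (pfst (pfst n)) (psnd (pfst n)) s"
      "(LEAST s. near (pfst (pfst n)) (psnd (pfst n)) s) = psnd n"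
      by (simp_all add: release_iff)
    then have "active (pfst (pfst n)) (Suc (psnd (pfst n)))"
      "k = follower_index (pfst (pfst n)) (Suc (psnd (pfst n)))"
      by (simp_all add: k active_def follower_index_def)
    then show ?thesis by (rule follower)
  next
    case False
    then show ?thesis using k by (rule spare)
  qed
qed

section \<open>Injectivity and range of the numbering\<close>

lemma follower_released:
  assumes "\<exists>s. near e t s"
  shows "follower e t = b (prod_encode (prod_encode (e, t), LEAST s. near e t s))"
    "release e t (LEAST s. near e t s)"
  using assms by (auto simp: follower_def release_iff)

lemma follower_kept:
  assumes "\<nexists>s. near e t s"
  shows "follower e t = a e" "a e \<notin> range b" "\<And>i. i < e \<Longrightarrow> a i \<noteq> a e"
proof -
  have "a e \<notin> a ` {..<e} \<union> range b" using assms near_iff[of e] by blast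
  then show "a e \<notin> range b" "\<And>i. i < e \<Longrightarrow> a i \<noteq> a e" by (auto, metis imageI lessThan_iff)
  show "follower e t = a e" using assms by (auto simp: follower_def)
qed

text \<open>Released followers hold spare values with different numbers, none of which is listed at
  its own odd index. A kept follower holds a value of \<open>a\<close> that lies outside
  \<open>range b\<close> and differs from all values with smaller \<open>e\<close>.\<close>

lemma inj_numbering: "inj numbering"
proof (rule injI)
  have spare_ne: "follower e t \<noteq> b n" if "\<not> release (pfst (pfst n)) (psnd (pfst n)) (psnd n)" for e t n
  proof (cases "\<exists>s. near e t s")
    case True
    from follower_released[OF this] that inj_b show ?thesis by (auto dest: injD)
  next
    case False
    from follower_kept[OF this] show ?thesis by auto
  qed
  fix k k' assume eq: "numbering k = numbering k'"
  show "k = k'"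
  proof (cases k rule: index_cases)
    case k: (follower e t)
    show ?thesis
    proof (cases k' rule: index_cases)
      case k': (follower e' t')
      have eq: "follower e t = follower e' t'"
        using eq k k' by (simp add: numbering_follower_index)
      have "e = e' \<and> t = t'"
      proof (cases "\<exists>s. near e t s"; cases "\<exists>s. near e' t' s")
        assume "\<exists>s. near e t s" "\<exists>s. near e' t' s"
        then show ?thesis
          using eq follower_released(1)[of e t] follower_released(1)[of e' t'] by (simp add: inj_eq[OF inj_b])
      next
        assume "\<exists>s. near e t s" "\<nexists>s. near e' t' s"
        then show ?thesis using eq follower_released(1)[of e t] follower_kept(1,2)[of e' t'] by (metis rangeI)
      next
        assume "\<nexists>s. near e t s" "\<exists>s. near e' t' s"
        then show ?thesis using eq follower_released(1)[of e' t'] follower_kept(1,2)[of e t] by (metis rangeI)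
      next
        assume n: "\<nexists>s. near e t s" "\<nexists>s. near e' t' s"
        then have "e = e'"
          using eq follower_kept[of e t] follower_kept[of e' t'] by (metis linorder_neqE_nat)
        \<comment> \<open>Among the followers of one \<open>e\<close>, at most one is active and
          kept: if a later one is active, every earlier one was released.\<close>
        moreover have "\<not> u < u'" if "active e u'" "\<nexists>s. near e u s" for u u'
          using that near_le by (cases u') (auto simp: active_def less_Suc_eq_le, blast)
        ultimately show ?thesis using n k(1) k'(1) by (metis linorder_neqE_nat)
      qed
      then show ?thesis using k k' by simp
    next
      case (spare n)
      then show ?thesis using eq k spare_ne by (simp add: numbering_follower_index numbering_spare)
    qed
  next
    case k: (spare n)
    show ?thesis
    proof (cases k' rule: index_cases)
      case (follower e t)
      then show ?thesis using eq k spare_ne by (metis numbering_follower_index numbering_spare)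
    next
      case (spare n')
      then show ?thesis using eq k injD[OF inj_b] by (simp add: numbering_spare)
    qed
  qed
qed

lemma b_in_range: "b n \<in> range numbering"
proof (cases "release (pfst (pfst n)) (psnd (pfst n)) (psnd n)")
  case False
  then show ?thesis by (metis numbering_spare rangeI)
next
  case True
  let ?e = "pfst (pfst n)" and ?t = "psnd (pfst n)"
  have near: "near ?e ?t (psnd n)" using True by (simp add: release_def)
  \<comment> \<open>Evidence at one precision is evidence at the preceding one, so the preceding
    follower was released.\<close>
  have "active ?e ?t"
    by (cases ?t) (use near near_antimono in \<open>auto simp: active_def\<close>)
  moreover have "(LEAST s. near ?e ?t s) = psnd n" using True by (simp add: release_iff)
  then have "follower ?e ?t = b n" using follower_released(1)[of ?e ?t] near by auto
  ultimately show ?thesis by (metis numbering_follower_index rangeI)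
qed

text \<open>A repeated value is listed by induction or as a spare value; a new one is kept by the
  first follower that never meets evidence.\<close>

lemma a_in_range: "a e \<in> range numbering"
proof (induction e rule: less_induct)
  case (less e)
  show ?case
  proof (cases "a e \<in> a ` {..<e} \<union> range b")
    case True
    then show ?thesis using less b_in_range by auto
  next
    case False
    then obtain t where "\<nexists>s. near e t s" using near_iff by blast
    then obtain t where t: "\<nexists>s. near e t s" "\<And>u. u < t \<Longrightarrow> \<exists>s. near e u s"
      using exists_least_iff[of "\<lambda>t. \<nexists>s. near e t s"] by blast
    have "active e t" using t(2) by (cases t) (auto simp: active_def)
    with follower_kept(1)[OF t(1)] show ?thesis by (metis numbering_follower_index rangeI)
  qed
qed

lemma range_numbering: "range numbering = range a \<union> range b"
proof -
  have "follower e t \<in> range a \<union> range b" for e t by (simp add: follower_def)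
  then have "numbering k \<in> range a \<union> range b" for k unfolding numbering_def Let_def by auto
  then show ?thesis using a_in_range b_in_range by auto
qed

end

context universal_machine
begin

section \<open>The Friedberg numbering\<close>

text \<open>The bound \<open>t \<le> s\<close> discards early stages, where coarse approximations
  may coincide and so agree to every precision; \<open>n \<le> s\<close> keeps the search among
  spare reals finite.\<close>

definition near :: "nat \<Rightarrow> nat \<Rightarrow> nat \<Rightarrow> bool" where
  "near e t s \<longleftrightarrow> t \<le> s \<and>
     ((\<exists>i<e. grid_close t s (random_approx i s) (random_approx e s)) \<or>
      (\<exists>n\<le>s. grid_close t s (spare_approx n s) (random_approx e s)))"

lemma decidable_near [computable_intros]:
  assumes e: "computable e" and t: "computable t" and s: "computable s"
  shows "decidable (\<lambda>z. near (e z) (t z) (s z))"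
  unfolding near_def
  by (intro computable_intros assms computable_compose[OF e] computable_compose[OF t]
      computable_compose[OF s])

lemma near_antimono: "near e (Suc t) s \<Longrightarrow> near e t s"
proof -
  have "grid_close t s x y" if "grid_close (Suc t) s x y" for x y
    using that by (auto simp: grid_close_def)
  then show "near e (Suc t) s \<Longrightarrow> near e t s" unfolding near_def by (meson Suc_leD)
qed

lemma near_iff:
  "(\<forall>t. \<exists>s. near e t s) \<longleftrightarrow> random_real e \<in> random_real ` {..<e} \<union> range spare_real"
proof
  assume "random_real e \<in> random_real ` {..<e} \<union> range spare_real"
  then consider i where "i < e" "random_real i = random_real e" | n where "spare_real n = random_real e"
    by force
  then show "\<forall>t. \<exists>s. near e t s"
  proof cases
    case 1
    have "\<forall>\<^sub>F s in sequentially. near e t s" for t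
      using eventually_grid_close[OF grid_seq_random_approx grid_seq_random_approx
          1(2)[unfolded random_real_def], of t] eventually_ge_at_top[of t]
      by eventually_elim (use 1(1) in \<open>auto simp: near_def\<close>)
    then show ?thesis using eventually_happens by fastforce
  next
    case 2
    have "\<forall>\<^sub>F s in sequentially. near e t s" for t
      using eventually_grid_close[OF grid_seq_spare_approx grid_seq_random_approx
          2[unfolded spare_real_def random_real_def], of t]
        eventually_ge_at_top[of t] eventually_ge_at_top[of n]
      by eventually_elim (auto simp: near_def)
    then show ?thesis using eventually_happens by fastforce
  qed
next
  assume near: "\<forall>t. \<exists>s. near e t s"
  show "random_real e \<in> random_real ` {..<e} \<union> range spare_real"
  proof (rule ccontr)
    assume "\<not> ?thesis"
    then have ne: "\<forall>i<e. random_real i \<noteq> random_real e" and ne': "\<forall>n. spare_real n \<noteq> random_real e"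
      by (metis UnI1 imageI lessThan_iff, metis UnI2 rangeI)
    \<comment> \<open>Half of the gap below 1 bounds the distance of the spare reals
      \<open>n \<ge> N\<close> from 1, the other half the precision. Convergence is then needed only
      for finitely many spare reals.\<close>
    have "0 < (1 - random_real e) / 2" using random_real(2)[of e] by simp
    then have half: "\<forall>\<^sub>F t in sequentially. 1 / 2 ^ t < (1 - random_real e) / 2"
      by (rule eventually_power_half_less)
    then obtain N where N: "1 / 2 ^ N < (1 - random_real e) / 2"
      using eventually_happens by fastforce
    have "\<forall>\<^sub>F t in sequentially. \<forall>i\<in>{..<e}. \<forall>s\<ge>t.
        \<not> grid_close t s (random_approx i s) (random_approx e s)"
      using ne by (intro eventually_ball_finite ballI eventually_not_grid_close grid_seq_random_approx)
        (simp_all flip: random_real_def)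
    moreover have "\<forall>\<^sub>F t in sequentially. \<forall>n\<in>{..<N}. \<forall>s\<ge>t.
        \<not> grid_close t s (spare_approx n s) (random_approx e s)"
      using ne' by (intro eventually_ball_finite ballI eventually_not_grid_close
          grid_seq_random_approx grid_seq_spare_approx)
        (simp_all flip: random_real_def spare_real_def)
    ultimately have "\<forall>\<^sub>F t in sequentially. \<forall>s. \<not> near e t s"
      using half
    proof eventually_elim
      case (elim t)
      have "\<not> grid_close t s (spare_approx n s) (random_approx e s)" if "n \<le> s" "N \<le> n" for n s
      proof -
        have "real (random_approx e s) / 2 ^ s \<le> random_real e"
          unfolding random_real_def by (rule grid_seq_le_lim[OF grid_seq_random_approx])
        moreover have "1 / 2 ^ n \<le> (1 / 2 ^ N :: real)"
          using that by (intro divide_left_mono power_increasing) auto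
        ultimately have "1 / 2 ^ t < real (spare_approx n s) / 2 ^ s - real (random_approx e s) / 2 ^ s"
          using spare_approx_lower[OF that(1)] N elim(3) by argo
        then show ?thesis unfolding grid_close_iff by linarith
      qed
      then show ?case using elim(1,2) unfolding near_def by (meson lessThan_iff not_le)
    qed
    then show False using near eventually_happens by fastforce
  qed
qed

sublocale reals: friedberg_construction random_real spare_real near
  using inj_spare_real near_antimono near_iff by unfold_locales

lemma decidable_release [computable_intros]:
  assumes e: "computable e" and t: "computable t" and s: "computable s"
  shows "decidable (\<lambda>z. reals.release (e z) (t z) (s z))"
  unfolding reals.release_def
  by (intro computable_intros assms computable_compose[OF e] computable_compose[OF t]
      computable_compose[OF s])

text \<open>The alternative \<open>s < v\<close> makes the search total; in this branch it does not
  affect the result.\<close>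

definition follower_approx :: "nat \<Rightarrow> nat \<Rightarrow> nat \<Rightarrow> nat" where
  "follower_approx e t s = (if \<exists>v\<le>s. near e t v
     then spare_approx (prod_encode (prod_encode (e, t), LEAST v. s < v \<or> near e t v)) s
     else random_approx e s)"

lemma computable_follower_approx [computable_intros]:
  assumes e: "computable e" and t: "computable t" and s: "computable s"
  shows "computable (\<lambda>z. follower_approx (e z) (t z) (s z))"
proof -
  have "\<exists>v. s z < v \<or> near (e z) (t z) v" for z by blast
  then have "computable (\<lambda>z. LEAST v. s z < v \<or> near (e z) (t z) v)"
    by (intro computable_Least computable_intros computable_compose[OF e] computable_compose[OF t]
      computable_compose[OF s])
  then show ?thesis unfolding follower_approx_def
    by (intro computable_intros assms computable_compose[OF e] computable_compose[OF t]
      computable_compose[OF s])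
qed

text \<open>Only the supremum over the stages counts: those before the switch must not exceed the
  spare real, and the later ones converge to it.\<close>

lemma less_follower_iff:
  "q < reals.follower e t \<longleftrightarrow> (\<exists>s. q < real (follower_approx e t s) / 2 ^ s)"
proof (cases "\<exists>v. near e t v")
  case False
  then show ?thesis
    by (simp add: reals.follower_def follower_approx_def random_real_def
        less_grid_lim_iff[OF grid_seq_random_approx])
next
  case True
  define v where "v = (LEAST v. near e t v)"
  define n where "n = prod_encode (prod_encode (e, t), v)"
  have v: "near e t v" "\<And>u. near e t u \<Longrightarrow> v \<le> u"
    unfolding v_def using True by (auto intro: LeastI Least_le)
  have follower: "reals.follower e t = spare_real n"
    using True by (simp add: reals.follower_def n_def v_def)
  have late: "follower_approx e t s = spare_approx n s" if "v \<le> s" for s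
  proof -
    have "(LEAST u. s < u \<or> near e t u) = v"
      by (rule Least_equality) (use v that in auto)
    then show ?thesis using v(1) that by (auto simp: follower_approx_def n_def)
  qed
  have early: "follower_approx e t s = random_approx e s" if "s < v" for s
    using v(2) that unfolding follower_approx_def by (meson le_less_trans not_le)
  have "real (follower_approx e t s) / 2 ^ s \<le> spare_real n" for s
  proof (cases "v \<le> s")
    case True
    then show ?thesis
      unfolding late[OF True] spare_real_def by (intro grid_seq_le_lim grid_seq_spare_approx)
  next
    case False
    \<comment> \<open>The pairing dominates its components, so \<open>s < v \<le> n\<close>: the old
      bound \<open>1 - 1 / 2 ^ s\<close> is at most \<open>1 - 1 / 2 ^ n\<close>.\<close>
    then have "s \<le> n" using le_prod_encode_2[of v "prod_encode (e, t)"] by (simp add: n_def)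
    then have "1 / 2 ^ n \<le> (1 / 2 ^ s :: real)" by (intro divide_left_mono power_increasing) auto
    then show ?thesis
      using early[of s] False grid_seq_le_1[OF grid_seq_random_approx, of e s] spare_real_lower[of n]
      by simp
  qed
  moreover have "\<exists>s. q < real (follower_approx e t s) / 2 ^ s" if "q < spare_real n"
  proof -
    have "\<forall>\<^sub>F s in sequentially. q < real (follower_approx e t s) / 2 ^ s"
      using eventually_less_grid_seq[OF grid_seq_spare_approx that[unfolded spare_real_def]]
        eventually_ge_at_top[of v] by eventually_elim (simp add: late)
    then show ?thesis using eventually_happens by fastforce
  qed
  ultimately show ?thesis unfolding follower by (meson less_le_trans)
qed

text \<open>\<open>k div 2 ^ 1\<close> is halving in the form covered by
  \<open>computable_div_power2\<close>. As \<open>release\<close> is decidable, the kind of an index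
  is known at once; only followers switch during the approximation.\<close>

definition numbering_approx :: "nat \<Rightarrow> nat \<Rightarrow> nat" where
  "numbering_approx k s =
     (if k mod 2 = 0 then follower_approx (k div 2 ^ 1) 0 s
      else if reals.release (pfst (pfst (k div 2 ^ 1))) (psnd (pfst (k div 2 ^ 1))) (psnd (k div 2 ^ 1))
        then follower_approx (pfst (pfst (k div 2 ^ 1))) (Suc (psnd (pfst (k div 2 ^ 1)))) s
      else spare_approx (k div 2 ^ 1) s)"

lemma computable_numbering_approx [computable_intros]:
  assumes "computable k" "computable s"
  shows "computable (\<lambda>z. numbering_approx (k z) (s z))"
  unfolding numbering_approx_def by (intro computable_intros assms)

lemma less_numbering_iff:
  "q < reals.numbering k \<longleftrightarrow> (\<exists>s. q < real (numbering_approx k s) / 2 ^ s)"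
  unfolding reals.numbering_def numbering_approx_def Let_def
  by (simp add: less_follower_iff even_iff_mod_2_eq_zero spare_real_def
      less_grid_lim_iff[OF grid_seq_spare_approx])

lemma numbering_real:
  "0 \<le> reals.numbering k" "reals.numbering k < 1" "martin_loef_random U (bits (reals.numbering k))"
proof -
  have "reals.numbering k \<in> range random_real \<union> range spare_real"
    using reals.range_numbering by blast
  then show "0 \<le> reals.numbering k" "reals.numbering k < 1"
    "martin_loef_random U (bits (reals.numbering k))"
    using random_real spare_real by auto
qed

lemma dyadic_below_numbering_iff:
  "dyadic_of_code n \<in> dyadics \<and> dyadic_of_code n < reals.numbering k \<longleftrightarrow>
     (\<exists>s. pfst n * 2 ^ s < numbering_approx k s * 2 ^ psnd n)"
proof -
  have q: "dyadic_of_code n = real (pfst n) / 2 ^ psnd n"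
    by (simp add: dyadic_of_code_def case_prod_beta)
  have "dyadic_of_code n \<in> dyadics" if "dyadic_of_code n < reals.numbering k"
  proof -
    have "dyadic_of_code n \<le> 1" using that numbering_real(2)[of k] by linarith
    then show ?thesis unfolding q dyadics_def by blast
  qed
  moreover have "dyadic_of_code n < real x / 2 ^ s \<longleftrightarrow> pfst n * 2 ^ s < x * 2 ^ psnd n" for x s
  proof -
    have "pfst n * 2 ^ s < x * 2 ^ psnd n \<longleftrightarrow> real (pfst n * 2 ^ s) < real (x * 2 ^ psnd n)"
      by (rule of_nat_less_iff[symmetric])
    then show ?thesis unfolding q by (simp add: field_simps)
  qed
  ultimately show ?thesis by (simp add: less_numbering_iff) blast
qed

lemma ce_numbering:
  "ce_dyadic_nat_set {(q, k). q \<in> dyadics \<and> q < reals.numbering k}"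
proof -
  have "ce_set {z. \<exists>s. pfst (pfst z) * 2 ^ s < numbering_approx (psnd z) s * 2 ^ psnd (pfst z)}"
    by (intro ce_set_ex computable_intros)
  also have "{z. \<exists>s. pfst (pfst z) * 2 ^ s < numbering_approx (psnd z) s * 2 ^ psnd (pfst z)} =
      {prod_encode (n, k) |n k. (dyadic_of_code n, k) \<in> {(q, k). q \<in> dyadics \<and> q < reals.numbering k}}"
  proof (intro set_eqI iffI)
    fix z
    assume "z \<in> {z. \<exists>s. pfst (pfst z) * 2 ^ s < numbering_approx (psnd z) s * 2 ^ psnd (pfst z)}"
    then have "dyadic_of_code (pfst z) \<in> dyadics \<and> dyadic_of_code (pfst z) < reals.numbering (psnd z)"
      unfolding dyadic_below_numbering_iff by simp
    moreover have "z = prod_encode (pfst z, psnd z)" by simp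
    ultimately show "z \<in> {prod_encode (n, k) |n k.
        (dyadic_of_code n, k) \<in> {(q, k). q \<in> dyadics \<and> q < reals.numbering k}}" by blast
  qed (auto simp: dyadic_below_numbering_iff)
  finally show ?thesis by (simp add: ce_dyadic_nat_set_def)
qed

lemma left_ce_numbering: "left_ce (bits (reals.numbering k))"
proof -
  have "ce_set {n. \<exists>s. pfst n * 2 ^ s < numbering_approx k s * 2 ^ psnd n}"
    by (intro ce_set_ex computable_intros)
  then show ?thesis
    by (simp add: left_ce_def ce_dyadic_set_def real_of_bitseq_bits numbering_real
        dyadic_below_numbering_iff)
qed

lemma friedberg_numbering_bits:
  "friedberg_numbering (\<lambda>k. bits (reals.numbering k)) {x. left_ce x \<and> martin_loef_random U x}"
proof -
  have real: "real_of_bitseq (bits (reals.numbering k)) = reals.numbering k" for k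
    by (rule real_of_bitseq_bits[OF numbering_real(1,2)])
  have "range (\<lambda>k. bits (reals.numbering k)) = {x. left_ce x \<and> martin_loef_random U x}"
  proof (intro subset_antisym subsetI)
    fix x assume "x \<in> {x. left_ce x \<and> martin_loef_random U x}"
    then have x: "left_ce x" "martin_loef_random U x" by simp_all
    then obtain p where "random_real p = real_of_bitseq x" using ex_random_real by blast
    then obtain k where "reals.numbering k = real_of_bitseq x"
      using reals.a_in_range[of p] by (metis rangeE)
    \<comment> \<open>A random sequence does not end in ones, so its real value determines
      it.\<close>
    then have "bits (reals.numbering k) = x"
      using bitseq_eq_bits(3)[OF random_not_eventually_true[OF universal x(2)]] by simp
    then show "x \<in> range (\<lambda>k. bits (reals.numbering k))" by blast
  qed (use left_ce_numbering numbering_real(3) in auto)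
  moreover have "inj (\<lambda>k. bits (reals.numbering k))"
  proof (rule injI)
    fix k k' assume "bits (reals.numbering k) = bits (reals.numbering k')"
    then have "reals.numbering k = reals.numbering k'" using real by metis
    then show "k = k'" by (rule injD[OF reals.inj_numbering])
  qed
  ultimately show ?thesis
    using ce_numbering by (simp add: friedberg_numbering_def effective_numbering_def real)
qed

end

theorem theorem8:
  fixes U :: "bitstring \<rightharpoonup> bitstring"
  assumes "universal_prefix_free_machine U"
  shows "\<exists>r. friedberg_numbering r {x. left_ce x \<and> martin_loef_random U x}"
proof -
  obtain f where f: "partial_recursive f" "\<And>\<sigma>. f (string_code \<sigma>) = map_option string_code (U \<sigma>)"
    using assms unfolding universal_prefix_free_machine_def prefix_free_machine_def
      computable_on_strings_def by blast
  obtain F where "stage_approx F f" using ex_stage_approx[OF f(1)] by blast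
  then interpret universal_machine U f F
    using assms f(2) by unfold_locales
  show ?thesis using friedberg_numbering_bits by blast
qed

end
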